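(* Define $$\mathcal{G}_{\mathrm{tree}}(x,q)=x^2\left(1+\sum_{i=1}^{\infty}\sum_{j=1}^{i}\frac{1}{i}\binom{2i+j}{2i+1}\binom{i}{j}q^{2i-j}x^{2i}\right).$$ Then for all integers $k\ge 1$ and $r\ge 0$, the number of orthogonal Grassmannian trees of type $\underline{k}$ with $\mathcal{O}$-dimension $r$ equals the coefficient $[x^{2k}q^r]\,\mathcal{G}_{\mathrm{tree}}(x,q)$. Moreover, $\mathcal{G}_{\mathrm{tree}}=\mathcal{G}_{\mathrm{tree}}(x,q)$ is algebraic of degree $3$ and satisfies $$q(q+1)\,\mathcal{G}_{\mathrm{tree}}^3-q^2x^2\,\mathcal{G}_{\mathrm{tree}}^2-x^2\,\mathcal{G}_{\mathrm{tree}}+x^4=0 .$$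
   Context: A planar tree on $n$ leaves is a tree properly embedded in a closed disk, considered up to homeomorphism, having $n$ boundary vertices, each of degree one, lying on the boundary of the disk and labelled $1,\dots,n$ in clockwise order; all other vertices are internal vertices, lying in the interior of the disk. An orthogonal Grassmannian tree (OG tree) of type $\underline{k}$ is a planar tree on $2k$ leaves in which every internal vertex $v$ has even degree $\deg(v)\ge 4$ (each internal vertex carries the helicity $h(v)=\deg(v)/2$, which is determined by its degree). For $k=1$ the only OG tree is the single edge joining the two boundary vertices, with no internal vertices. The $\mathcal{O}$-dimension of an OG tree $T$ of type $\underline{k}$ is $0$ if $k=1$ and $\sum_{v}(\deg(v)-3)$, the sum being over the internal vertices $v$ of $T$, if $k>1$. "Algebraic of degree $3$" means algebraic of degree $3$ over $\mathbb{Q}(x,q)$. *)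

theory Defs
  imports
    "HOL-Combinatorics.Orbits"
    "HOL-Computational_Algebra.Computational_Algebra"
begin

section \<open>Planar trees\<close>

text \<open>
  A finite tree embedded in an oriented disk is determined, up to orientation-preserving
  homeomorphism, by its rotation system: the clockwise cyclic order of the neighbours around every
  vertex.  Accordingly, a planar tree consists of a finite tree together with a rotation
  \<open>rot T v\<close> (\<open>rot T v u\<close> is the neighbour of \<open>v\<close> following \<open>u\<close> clockwise around \<open>v\<close>) and the
  boundary vertices \<open>bdry T 1, \<dots>, bdry T n\<close>, and homeomorphism becomes isomorphism of such data.
  Values of \<open>rot T v u\<close> with \<open>u\<close> not adjacent to \<open>v\<close> and of \<open>bdry T i\<close> with
  \<open>i\<close> outside \<open>{1..n}\<close> are meaningless and are ignored by the isomorphisms.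
\<close>

record embedded_graph =
  verts :: "nat set"
  adj :: "(nat \<times> nat) set"
  rot :: "nat \<Rightarrow> nat \<Rightarrow> nat"
  bdry :: "nat \<Rightarrow> nat"

definition nbrs :: "embedded_graph \<Rightarrow> nat \<Rightarrow> nat set" where
  "nbrs T v = {u. (v, u) \<in> adj T}"

definition deg :: "embedded_graph \<Rightarrow> nat \<Rightarrow> nat" where
  "deg T v = card (nbrs T v)"

definition is_simple_graph :: "embedded_graph \<Rightarrow> bool" where
  "is_simple_graph T \<longleftrightarrow>
     finite (verts T) \<and> adj T \<subseteq> verts T \<times> verts T \<and> sym (adj T) \<and> irrefl (adj T)"

definition is_cycle :: "embedded_graph \<Rightarrow> nat list \<Rightarrow> bool" where
  "is_cycle T c \<longleftrightarrow>
     length c \<ge> 3 \<and> distinct c \<and> successively (\<lambda>u v. (u, v) \<in> adj T) c \<and>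
     (last c, hd c) \<in> adj T"

definition is_tree :: "embedded_graph \<Rightarrow> bool" where
  "is_tree T \<longleftrightarrow>
     is_simple_graph T \<and> verts T \<noteq> {} \<and>
     (\<forall>u\<in>verts T. \<forall>v\<in>verts T. (u, v) \<in> (adj T)\<^sup>*) \<and> (\<nexists>c. is_cycle T c)"

text \<open>
  After traversing the edge from \<open>u\<close> to \<open>v\<close>, continue along the edge at \<open>v\<close> that follows
  clockwise after the one just used.  Iterating this walks once around the tree, clockwise as seen
  from outside, and so meets the boundary vertices in the clockwise order in which they lie on
  the boundary circle.
\<close>

definition contour_step :: "embedded_graph \<Rightarrow> nat \<times> nat \<Rightarrow> nat \<times> nat" where
  "contour_step T = (\<lambda>(u, v). (v, rot T v u))"

text \<open>\<open>b\<close> is the first element of \<open>B\<close> met by the contour walk that starts out from \<open>a\<close>.\<close>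

definition next_clockwise :: "embedded_graph \<Rightarrow> nat set \<Rightarrow> nat \<Rightarrow> nat \<Rightarrow> bool" where
  "next_clockwise T B a b \<longleftrightarrow>
     (\<exists>w\<in>nbrs T a. \<exists>m. snd ((contour_step T ^^ m) (a, w)) = b \<and>
        (\<forall>j<m. snd ((contour_step T ^^ j) (a, w)) \<notin> B))"

definition planar_tree :: "nat \<Rightarrow> embedded_graph \<Rightarrow> bool" where
  "planar_tree n T \<longleftrightarrow>
     is_tree T \<and>
     (\<forall>v\<in>verts T. nbrs T v \<noteq> {} \<longrightarrow> cyclic_on (rot T v) (nbrs T v)) \<and>
     inj_on (bdry T) {1..n} \<and> bdry T ` {1..n} \<subseteq> verts T \<and>
     (\<forall>i\<in>{1..n}. deg T (bdry T i) = 1) \<and>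
     (\<forall>i\<in>{1..n}. next_clockwise T (bdry T ` {1..n}) (bdry T i) (bdry T (i mod n + 1)))"

definition internal_verts :: "nat \<Rightarrow> embedded_graph \<Rightarrow> nat set" where
  "internal_verts n T = verts T - bdry T ` {1..n}"

definition planar_iso :: "nat \<Rightarrow> embedded_graph \<Rightarrow> embedded_graph \<Rightarrow> (nat \<Rightarrow> nat) \<Rightarrow> bool" where
  "planar_iso n S T f \<longleftrightarrow>
     bij_betw f (verts S) (verts T) \<and>
     (\<forall>u\<in>verts S. \<forall>v\<in>verts S. (f u, f v) \<in> adj T \<longleftrightarrow> (u, v) \<in> adj S) \<and>
     (\<forall>v\<in>verts S. \<forall>u\<in>nbrs S v. rot T (f v) (f u) = f (rot S v u)) \<and>
     (\<forall>i\<in>{1..n}. bdry T i = f (bdry S i))"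

definition planar_iso_rel :: "nat \<Rightarrow> (embedded_graph \<times> embedded_graph) set" where
  "planar_iso_rel n =
     {(S, T). planar_tree n S \<and> planar_tree n T \<and> (\<exists>f. planar_iso n S T f)}"

lemma planar_iso_refl: "planar_iso n T T (\<lambda>v. v)"
  by (auto simp: planar_iso_def bij_betw_def)

lemma planar_tree_rot_in:
  assumes "planar_tree n T" "v \<in> verts T" "u \<in> nbrs T v"
  shows "rot T v u \<in> nbrs T v" "u \<in> verts T"
proof -
  have "cyclic_on (rot T v) (nbrs T v)"
    using assms unfolding planar_tree_def by blast
  then show "rot T v u \<in> nbrs T v"
    using assms(3) by (rule cyclic_on_inI)
  show "u \<in> verts T"
    using assms by (auto simp: planar_tree_def is_tree_def is_simple_graph_def nbrs_def)
qed

lemma planar_iso_nbrs: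
  assumes "planar_iso n S T f" "v \<in> verts S" "u \<in> verts S"
  shows "f u \<in> nbrs T (f v) \<longleftrightarrow> u \<in> nbrs S v"
  using assms by (auto simp: planar_iso_def nbrs_def)

lemma planar_iso_trans:
  assumes S: "planar_tree n S" and f: "planar_iso n S T f" and g: "planar_iso n T U g"
  shows "planar_iso n S U (g \<circ> f)"
proof -
  have fv: "f v \<in> verts T" if "v \<in> verts S" for v
    using f that by (auto simp: planar_iso_def bij_betw_def)
  have "rot U (g (f v)) (g (f u)) = g (f (rot S v u))"
    if v: "v \<in> verts S" and u: "u \<in> nbrs S v" for u v
  proof -
    have "u \<in> verts S" by (rule planar_tree_rot_in(2)[OF S v u])
    then have "f u \<in> nbrs T (f v)" using planar_iso_nbrs[OF f v] u by simp
    then have "rot U (g (f v)) (g (f u)) = g (rot T (f v) (f u))"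
      using g fv[OF v] by (auto simp: planar_iso_def)
    also have "rot T (f v) (f u) = f (rot S v u)"
      using f v u by (auto simp: planar_iso_def)
    finally show ?thesis .
  qed
  then show ?thesis
    using f g fv by (auto simp: planar_iso_def intro: bij_betw_trans)
qed

lemma planar_iso_sym:
  assumes S: "planar_tree n S" and T: "planar_tree n T" and f: "planar_iso n S T f"
  shows "planar_iso n T S (inv_into (verts S) f)"
proof -
  let ?g = "inv_into (verts S) f"
  have b: "bij_betw f (verts S) (verts T)" using f by (simp add: planar_iso_def)
  have g: "bij_betw ?g (verts T) (verts S)" by (rule bij_betw_inv_into[OF b])
  have gf: "?g (f v) = v" if "v \<in> verts S" for v
    using b that by (rule bij_betw_inv_into_left)
  have fg: "f (?g v) = v" if "v \<in> verts T" for v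
    using b that by (rule bij_betw_inv_into_right)
  have gv: "?g v \<in> verts S" if "v \<in> verts T" for v
    using g that by (rule bij_betwE[rule_format])
  have adj: "(?g u, ?g v) \<in> adj S \<longleftrightarrow> (u, v) \<in> adj T"
    if "u \<in> verts T" "v \<in> verts T" for u v
    using f gv[OF that(1)] gv[OF that(2)] fg[OF that(1)] fg[OF that(2)]
    unfolding planar_iso_def by metis
  have "rot S (?g v) (?g u) = ?g (rot T v u)" if v: "v \<in> verts T" and u: "u \<in> nbrs T v" for u v
  proof -
    have uT: "u \<in> verts T" by (rule planar_tree_rot_in(2)[OF T v u])
    have uS: "?g u \<in> nbrs S (?g v)"
      using adj[OF v uT] u by (simp add: nbrs_def)
    have "rot S (?g v) (?g u) \<in> verts S"
      using planar_tree_rot_in[OF S gv[OF v]] uS by blast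
    moreover have "f (rot S (?g v) (?g u)) = rot T v u"
      using f gv[OF v] uS fg[OF v] fg[OF uT] unfolding planar_iso_def by metis
    ultimately show ?thesis using gf by metis
  qed
  moreover have "bdry S i = ?g (bdry T i)" if "i \<in> {1..n}" for i
  proof -
    have "bdry S i \<in> verts S" using S that by (auto simp: planar_tree_def)
    then show ?thesis using f gf that by (simp add: planar_iso_def)
  qed
  ultimately show ?thesis
    using g adj unfolding planar_iso_def by blast
qed

lemma equiv_planar_iso_rel: "equiv {T. planar_tree n T} (planar_iso_rel n)"
  unfolding equiv_def refl_on_def sym_def trans_def planar_iso_rel_def
  using planar_iso_refl planar_iso_sym planar_iso_trans by blast

section \<open>Orthogonal Grassmannian trees\<close>

definition OG_tree :: "nat \<Rightarrow> embedded_graph \<Rightarrow> bool" where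
  "OG_tree k T \<longleftrightarrow>
     planar_tree (2 * k) T \<and>
     (\<forall>v\<in>internal_verts (2 * k) T. even (deg T v) \<and> deg T v \<ge> 4)"

definition O_dimension :: "nat \<Rightarrow> embedded_graph \<Rightarrow> int" where
  "O_dimension k T =
     (if k = 1 then 0 else \<Sum>v\<in>internal_verts (2 * k) T. int (deg T v) - 3)"

definition OG_trees_of_dimension :: "nat \<Rightarrow> nat \<Rightarrow> embedded_graph set set" where
  "OG_trees_of_dimension k r =
     {T. OG_tree k T \<and> O_dimension k T = int r} // planar_iso_rel (2 * k)"

section \<open>The generating function\<close>

text \<open>
  The series lives in \<open>\<rat>[q]\<lbrakk>x\<rbrakk>\<close>: every coefficient with respect to \<open>x\<close> is a polynomial in \<open>q\<close>.
\<close>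

definition qvar :: "rat poly fps" where
  "qvar = fps_const [:0, 1:]"

definition xvar :: "rat poly fps" where
  "xvar = fps_X"

text \<open>The sum over \<open>i \<ge> 1\<close> converges in the \<open>x\<close>-adic metric; the index is shifted by one.\<close>

definition G_summand :: "nat \<Rightarrow> rat poly fps" where
  "G_summand i =
     (\<Sum>j=1..i. fps_const [:1 / of_nat i * of_nat ((2*i + j) choose (2*i + 1)) * of_nat (i choose j):]
        * qvar ^ (2*i - j) * xvar ^ (2*i))"

lemma G_summand_altdef:
  "G_summand i =
     fps_const (\<Sum>j=1..i.
       monom (1 / of_nat i * of_nat ((2*i + j) choose (2*i + 1)) * of_nat (i choose j)) (2*i - j))
     * fps_X ^ (2*i)"
proof -
  have q: "qvar ^ n = fps_const (monom 1 n)" for n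
    by (simp add: qvar_def fps_const_power monom_altdef)
  have s: "fps_const (sum f A) = (\<Sum>j\<in>A. fps_const (f j))" for f :: "nat \<Rightarrow> rat poly" and A
    by (induction A rule: infinite_finite_induct) (auto simp flip: fps_const_add)
  show ?thesis
    unfolding G_summand_def q xvar_def s sum_distrib_right
    by (intro sum.cong refl) (simp add: smult_monom)
qed

lemma summable_G_summand: "summable (\<lambda>i. G_summand (Suc i))"
proof -
  have "eventually (\<lambda>m. fps_nth (\<Sum>i<m. G_summand (Suc i)) n =
          fps_nth (\<Sum>i<n. G_summand (Suc i)) n) sequentially" for n
    by (rule eventually_sequentiallyI[of n], simp add: fps_sum_nth, rule sum.mono_neutral_right)
       (auto simp: G_summand_altdef)
  then have "(\<lambda>i. G_summand (Suc i)) sums Abs_fps (\<lambda>n. fps_nth (\<Sum>i<n. G_summand (Suc i)) n)"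
    unfolding sums_def by (intro tendsto_fpsI) simp
  then show ?thesis by (rule sums_summable)
qed

definition G_tree :: "rat poly fps" where
  "G_tree = xvar\<^sup>2 * (1 + (\<Sum>i. G_summand (Suc i)))"

section \<open>Algebraicity over the field of rational functions\<close>

text \<open>Everything is embedded into the field \<open>\<rat>(q)((x))\<close>, which contains \<open>\<rat>(x, q)\<close>.\<close>

definition to_laurent :: "rat poly fps \<Rightarrow> rat poly fract fls" where
  "to_laurent F = fps_to_fls (Abs_fps (\<lambda>n. to_fract (fps_nth F n)))"

definition rational_functions :: "rat poly fract fls set" where
  "rational_functions =
     {to_laurent (fps_of_poly a) / to_laurent (fps_of_poly b) | a b. b \<noteq> 0}"

text \<open>
  \<open>a\<close> is algebraic of degree \<open>d\<close> over the subfield \<open>K\<close>: its minimal polynomial over \<open>K\<close>, the monic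
  polynomial of least degree over \<open>K\<close> vanishing at \<open>a\<close>, has degree \<open>d\<close>.
\<close>

definition algebraic_of_degree :: "'a::field set \<Rightarrow> 'a \<Rightarrow> nat \<Rightarrow> bool" where
  "algebraic_of_degree K a d \<longleftrightarrow>
     (\<exists>p. lead_coeff p = 1 \<and> degree p = d \<and> (\<forall>i. coeff p i \<in> K) \<and> poly p a = 0) \<and>
     (\<forall>p. p \<noteq> 0 \<and> (\<forall>i. coeff p i \<in> K) \<and> poly p a = 0 \<longrightarrow> d \<le> degree p)"

end

theory Submission
  imports Defs "HOL-Library.Countable"
begin

text \<open>
  Cutting an OG tree at the boundary vertex \<open>1\<close> leaves a plane tree whose inner nodes have an odd
  number \<open>m \<ge> 3\<close> of children and contribute \<open>m - 2\<close> to the dimension.  Its generating function \<open>T\<close>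
  satisfies \<open>(T - x) (1 - q\<^sup>2 T\<^sup>2) = q T\<^sup>3\<close>, that is, \<open>T\<close> is the compositional inverse of
  \<open>u (1 - q (q + 1) u\<^sup>2) / (1 - q\<^sup>2 u\<^sup>2)\<close>.  Lagrange inversion computes its coefficients and shows
  that the given series is \<open>x T\<close>.

  That isomorphism classes of OG trees correspond to plane trees is seen by unfolding an OG tree from
  the vertex \<open>1\<close>: this yields a plane tree together with a covering map from a canonical embedding of
  it, and a covering map of trees is an isomorphism.
\<close>

section \<open>The series\<close>

text \<open>The right-hand side of the equation for \<open>T\<close> comes from the geometric sum of
  \<open>q^(m-2) * T^m\<close> over odd \<open>m \<ge> 3\<close>, which is
  \<open>q * T^3 / (1 - q^2 * T^2)\<close>. In the coefficient formula \<open>j\<close> is the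
  number of inner nodes: for \<open>2*i + 1\<close> leaves the numbers \<open>m - 1\<close> add up
  to \<open>2*i\<close>, so the dimension is \<open>2*i - j\<close>. The factor \<open>x\<close> in
  \<open>x T\<close> accounts for the boundary vertex \<open>1\<close>. The obstacle on the
  geometric side is that a rotation system has neither a root nor levels, and its labels are
  constrained only through the contour walk. A covering map controls adjacency and rotation, not
  labels. Label \<open>1\<close> is matched by construction, and each further label is then forced,
  because the first boundary vertex met after leaving a leaf is unique. Different plane trees give
  different classes because unfolding from label \<open>1\<close> commutes with isomorphisms. Degree
  exactly 3 is obtained without an irreducibility criterion: relations of degree at most 2 are
  excluded directly.\<close>

lemma fps_compose_mult_nth:
  fixes a b c :: "'a::comm_ring_1 fps"
  assumes "fps_nth b 0 = 0"
  shows "fps_nth ((a oo b) * c) n = (\<Sum>i\<le>n. fps_nth a i * fps_nth (b ^ i * c) n)"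
proof -
  have z: "fps_nth (b ^ i) k = 0" if "k < i" for i k
    using assms that by (simp add: startsby_zero_power_prefix)
  have "fps_nth ((a oo b) * c) n
      = (\<Sum>k\<le>n. (\<Sum>i\<le>k. fps_nth a i * fps_nth (b ^ i) k) * fps_nth c (n - k))"
    by (simp add: fps_mult_nth fps_compose_nth atLeast0AtMost)
  \<comment> \<open>\<open>b ^ i\<close> has no terms below degree \<open>i\<close>, so all inner
    sums may run to the common bound \<open>n\<close> before the sums are swapped.\<close>
  also have "\<dots> = (\<Sum>k\<le>n. (\<Sum>i\<le>n. fps_nth a i * fps_nth (b ^ i) k) * fps_nth c (n - k))"
    by (intro sum.cong refl arg_cong2[where f="(*)"] sum.mono_neutral_left) (auto simp: z)
  also have "\<dots> = (\<Sum>i\<le>n. fps_nth a i * fps_nth (b ^ i * c) n)"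
    unfolding fps_mult_nth sum_distrib_right sum_distrib_left atLeast0AtMost mult.assoc
    by (rule sum.swap)
  finally show ?thesis .
qed

text \<open>The residue proof, kept inside power series: with \<open>f = fps_X * h\<close>, the
  series \<open>g\<close> plays the role of \<open>fps_X / f\<close>, so coefficient
  \<open>n - 1\<close> of \<open>f ^ i * f' * g ^ n\<close> is the residue of
  \<open>f' * f^(i-n)\<close>. Expanding \<open>T' oo f\<close> in powers of \<open>f\<close>, only
  \<open>i = n - 1\<close> survives.\<close>

lemma lagrange_inversion:
  fixes g h T :: "'a::{idom,ring_char_0} fps"
  assumes gh: "h * g = 1" and inv: "T oo (fps_X * h) = fps_X" and n: "n > 0"
  shows "of_nat n * fps_nth T n = fps_nth (g ^ n) (n - 1)"
proof -
  define f where "f = fps_X * h"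
  have f0: "fps_nth f 0 = 0" by (simp add: f_def)
  have df: "fps_deriv f = h + fps_X * fps_deriv h" by (simp add: f_def)
  have one: "(fps_deriv T oo f) * fps_deriv f = 1"
    using arg_cong[OF inv, of fps_deriv] f0 by (simp add: fps_compose_deriv f_def)
  have dg: "fps_deriv g = - (g\<^sup>2 * fps_deriv h)"
  proof -
    have "fps_deriv h * g + h * fps_deriv g = 0"
      using arg_cong[OF gh, of fps_deriv] by (simp add: algebra_simps)
    then have "g * (fps_deriv h * g + h * fps_deriv g) = 0" by simp
    then have "(h * g) * fps_deriv g = - (g\<^sup>2 * fps_deriv h)"
      by (simp add: algebra_simps power2_eq_square eq_neg_iff_add_eq_0)
    then show ?thesis by (simp add: gh)
  qed
  \<comment> \<open>This is the residue of \<open>f' / f\<^sup>k\<^sup>+\<^sup>1\<close>, which is an exact derivative for \<open>k > 0\<close>.\<close>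
  have key: "fps_nth (g ^ Suc k * fps_deriv f) k = (if k = 0 then 1 else 0)" for k
  proof -
    \<comment> \<open>For \<open>k > 0\<close> the two summands cancel in degree \<open>k\<close>:
      the derivative of \<open>g ^ k\<close> is \<open>- k * g ^ Suc k * h'\<close>, and
      \<open>k\<close> can be divided out in characteristic 0.\<close>
    have e: "g ^ Suc k * fps_deriv f = g ^ k + fps_X * (g ^ Suc k * fps_deriv h)"
      using gh by (simp add: df algebra_simps)
    show ?thesis
    proof (cases k)
      case 0
      then show ?thesis unfolding e by simp
    next
      case (Suc l)
      have "fps_deriv (g ^ k) = of_nat k * (fps_deriv g * g ^ l)"
        by (simp only: fps_deriv_power' Suc diff_Suc_1 mult.assoc mult.left_commute)
      then have "fps_deriv (g ^ k) = - (of_nat k * (g ^ Suc k * fps_deriv h))"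
        by (simp add: dg Suc power2_eq_square algebra_simps)
      then have "fps_nth (fps_deriv (g ^ k)) l = - (of_nat k * fps_nth (g ^ Suc k * fps_deriv h) l)"
        by (simp only: fps_of_nat[symmetric] fps_neg_nth fps_mult_left_const_nth)
      moreover have "fps_nth (fps_deriv (g ^ k)) l = of_nat k * fps_nth (g ^ k) k"
        by (simp only: Suc fps_deriv_nth Suc_eq_plus1)
      ultimately have "of_nat k * (fps_nth (g ^ k) k + fps_nth (g ^ Suc k * fps_deriv h) l) = 0"
        by (simp only: distrib_left add.left_inverse)
      moreover have "of_nat k \<noteq> (0 :: 'a)" by (simp only: of_nat_eq_0_iff Suc)
      ultimately have "fps_nth (g ^ k) k + fps_nth (g ^ Suc k * fps_deriv h) l = 0"
        by (simp only: mult_eq_0_iff simp_thms)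
      then show ?thesis unfolding e by (simp add: Suc del: power_Suc)
    qed
  qed
  have lagrange_term: "fps_nth (f ^ i * (fps_deriv f * g ^ n)) (n - 1) = (if i = n - 1 then 1 else 0)"
    if "i \<le> n - 1" for i
  proof -
    define k where "k = n - 1 - i"
    have nk: "n = i + Suc k" using that n by (simp add: k_def)
    \<comment> \<open>Of the \<open>n\<close> factors \<open>g\<close>, \<open>i\<close> cancel
      against those \<open>h\<close> that come from \<open>f ^ i\<close>; \<open>Suc k\<close>
      remain.\<close>
    have "h ^ i * g ^ n = (h * g) ^ i * g ^ Suc k"
      by (simp only: nk power_add power_mult_distrib mult.assoc)
    then have "h ^ i * g ^ n = g ^ Suc k" by (simp only: gh power_one mult_1_left)
    moreover have "f ^ i * (fps_deriv f * g ^ n) = fps_X ^ i * ((h ^ i * g ^ n) * fps_deriv f)"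
      unfolding f_def power_mult_distrib by (simp only: mult_ac)
    ultimately have "f ^ i * (fps_deriv f * g ^ n) = fps_X ^ i * (g ^ Suc k * fps_deriv f)"
      by (simp only:)
    then have "fps_nth (f ^ i * (fps_deriv f * g ^ n)) (n - 1) = fps_nth (g ^ Suc k * fps_deriv f) k"
      by (simp only: fps_X_power_mult_nth k_def) (use that in simp)
    then show ?thesis using key[of k] that by (simp only: k_def) auto
  qed
  have "fps_nth (g ^ n) (n - 1) = fps_nth ((fps_deriv T oo f) * (fps_deriv f * g ^ n)) (n - 1)"
    by (simp only: mult.assoc[symmetric] one mult_1_left)
  also have "\<dots> = (\<Sum>i\<le>n - 1. fps_nth (fps_deriv T) i * fps_nth (f ^ i * (fps_deriv f * g ^ n)) (n - 1))"
    by (rule fps_compose_mult_nth[OF f0])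
  also have "\<dots> = (\<Sum>i\<le>n - 1. if i = n - 1 then fps_nth (fps_deriv T) i else 0)"
    by (intro sum.cong refl) (simp only: atMost_iff lagrange_term mult_1_right mult_zero_right split: if_split, simp)
  also have "\<dots> = fps_nth (fps_deriv T) (n - 1)" by simp
  also have "\<dots> = of_nat n * fps_nth T n" using n by simp
  finally show ?thesis by simp
qed

section \<open>Coefficients of powers of geometric series\<close>

text \<open>The negative binomial series. By Pascal's rule, multiplication by
  \<open>1 - fps_X\<close> lowers \<open>n\<close> by one.\<close>

lemma choose_fps_mult_one_minus_X_power:
  "Abs_fps (\<lambda>j. of_nat ((n + j) choose j)) * (1 - fps_X) ^ Suc n = (1 :: 'a::comm_ring_1 fps)"
proof (induction n)
  case 0
  show ?case by (rule fps_ext) (auto simp: algebra_simps)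
next
  case (Suc n)
  have "Abs_fps (\<lambda>j. of_nat ((Suc n + j) choose j)) * (1 - fps_X)
      = (Abs_fps (\<lambda>j. of_nat ((n + j) choose j)) :: 'a fps)"
  proof (rule fps_ext)
    fix m
    show "fps_nth (Abs_fps (\<lambda>j. of_nat ((Suc n + j) choose j)) * (1 - fps_X)) m
      = fps_nth (Abs_fps (\<lambda>j. of_nat ((n + j) choose j)) :: 'a fps) m"
      by (cases m) (simp_all add: algebra_simps)
  qed
  then show ?case
    using Suc by (simp only: power_Suc[of _ "Suc n"] mult.assoc[symmetric])
qed

text \<open>Substituting \<open>z\<close> into the negative binomial series yields an inverse of
  \<open>(1 - z) ^ Suc n\<close>, and inverses are unique.\<close>

lemma geometric_power_nth:
  fixes g z :: "'a::idom fps"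
  assumes gz: "g * (1 - z) = 1" and z: "fps_nth z 0 = 0"
  shows "fps_nth (g ^ Suc n) m = (\<Sum>j\<le>m. of_nat ((n + j) choose j) * fps_nth (z ^ j) m)"
proof -
  define P :: "'a fps" where "P = Abs_fps (\<lambda>j. of_nat ((n + j) choose j))"
  have "(P * (1 - fps_X) ^ Suc n) oo z = 1"
    unfolding P_def choose_fps_mult_one_minus_X_power by simp
  then have "(P oo z) * (1 - z) ^ Suc n = 1"
    by (simp add: z fps_compose_mult_distrib fps_compose_sub_distrib fps_compose_power[symmetric]
        fps_X_fps_compose_startby0 del: power_Suc)
  then have "g ^ Suc n * ((P oo z) * (1 - z) ^ Suc n) = g ^ Suc n" by simp
  moreover have "g ^ Suc n * ((P oo z) * (1 - z) ^ Suc n) = (P oo z) * (g * (1 - z)) ^ Suc n"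
    by (simp only: power_mult_distrib mult_ac)
  ultimately have "g ^ Suc n = P oo z" by (simp only: gz power_one mult_1_right)
  then show ?thesis
    by (simp only: fps_compose_nth atLeast0AtMost P_def fps_nth_Abs_fps)
qed

lemma qvar_power: "qvar ^ n = fps_const (monom 1 n)"
  by (simp add: qvar_def fps_const_power monom_altdef)

text \<open>The hypothesis says that \<open>T\<close> is a right inverse of the rational function
  \<open>f\<close>, whereas Lagrange inversion needs \<open>T oo f = fps_X\<close>. Composing the
  equation with \<open>f\<close> shows that \<open>T oo f\<close> and \<open>fps_X\<close> solve the
  same cubic. The series \<open>g\<close> is presented as a nested geometric series so that its
  powers can be expanded twice.\<close>

lemma tree_series_lagrange:
  fixes T :: "rat poly fps"
  assumes T0: "fps_nth T 0 = 0"
    and T: "(T - fps_X) * (1 - qvar\<^sup>2 * T\<^sup>2) = qvar * T ^ 3"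
  obtains g c where "c * (1 - qvar\<^sup>2 * fps_X\<^sup>2) = 1" "g * (1 - qvar * fps_X\<^sup>2 * c) = 1"
    "\<And>n. n > 0 \<Longrightarrow> of_nat n * fps_nth T n = fps_nth (g ^ n) (n - 1)"
proof -
  define w :: "rat poly fps" where "w = fps_X\<^sup>2"
  define a :: "rat poly fps" where "a = 1 - qvar\<^sup>2 * w"
  define b :: "rat poly fps" where "b = 1 - qvar * (qvar + 1) * w"
  \<comment> \<open>The coefficients are polynomials in \<open>q\<close>, so the inverse is produced
    as a geometric series by substitution into \<open>1 / (1 - fps_X)\<close>.\<close>
  have geo: "\<exists>c. (c::rat poly fps) * (1 - fps_const d * w) = 1" for d
  proof -
    have "(Abs_fps (\<lambda>j. 1) * (1 - fps_X)) oo (fps_const d * w) = 1"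
      using choose_fps_mult_one_minus_X_power[of 0, where 'a="rat poly"] by simp
    then have "(Abs_fps (\<lambda>j. 1) oo (fps_const d * w)) * (1 - fps_const d * w) = 1"
      by (simp add: fps_compose_mult_distrib fps_compose_sub_distrib fps_X_fps_compose_startby0 w_def)
    then show ?thesis by blast
  qed
  have qc: "qvar\<^sup>2 = fps_const (monom 1 2)" "qvar * (qvar + 1) = fps_const ([:0,1:] * ([:0,1:] + 1))"
    by (simp_all add: qvar_power) (simp add: qvar_def)
  obtain ia where ia: "ia * a = 1" using geo unfolding a_def qc by blast
  obtain ib where ib: "ib * b = 1" using geo unfolding b_def qc by blast
  define h g where "h = b * ia" and "g = a * ib"
  have hg: "h * g = 1" 
  proof -
    have "h * g = (ia * a) * (ib * b)" by (simp only: h_def g_def mult_ac)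
    then show ?thesis by (simp only: ia ib mult_1)
  qed
  define f where "f = fps_X * h"
  have f0: "fps_nth f 0 = 0" by (simp add: f_def)
  have fa: "f * a = fps_X * b" 
  proof -
    have "f * a = (ia * a) * (fps_X * b)" by (simp only: f_def h_def mult_ac)
    then show ?thesis by (simp only: ia mult_1)
  qed
  define Y where "Y = T oo f"
  have cq: "qvar oo f = qvar" by (simp add: qvar_def)
  have "((T - fps_X) * (1 - qvar\<^sup>2 * T\<^sup>2)) oo f = (qvar * T ^ 3) oo f" by (simp only: T)
  then have Y: "(Y - f) * (1 - qvar\<^sup>2 * Y\<^sup>2) = qvar * Y ^ 3"
    by (simp add: f0 fps_compose_mult_distrib fps_compose_sub_distrib fps_compose_power[symmetric]
        fps_X_fps_compose_startby0 cq Y_def)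
  have X: "(fps_X - f) * (1 - qvar\<^sup>2 * fps_X\<^sup>2) = qvar * fps_X ^ 3"
    using fa by (simp add: a_def b_def w_def algebra_simps power2_eq_square power3_eq_cube)
  \<comment> \<open>\<open>U\<close> is the cofactor of \<open>Y - fps_X\<close> in the difference
    of the two cubic equations. Its constant term is 1, so it can be cancelled.\<close>
  define U where "U = 1 - qvar\<^sup>2 * (Y\<^sup>2 + Y * fps_X + fps_X\<^sup>2) + f * qvar\<^sup>2 * (Y + fps_X)
     - qvar * (Y\<^sup>2 + Y * fps_X + fps_X\<^sup>2)"
  have "(Y - fps_X) * U = ((Y - f) * (1 - qvar\<^sup>2 * Y\<^sup>2) - qvar * Y ^ 3)
      - ((fps_X - f) * (1 - qvar\<^sup>2 * fps_X\<^sup>2) - qvar * fps_X ^ 3)"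
    by (simp add: U_def algebra_simps power2_eq_square power3_eq_cube)
  also have "\<dots> = 0" by (simp only: X Y) simp
  finally have "(Y - fps_X) * U = 0" .
  moreover have "fps_nth U 0 = 1" by (simp add: U_def f0 Y_def T0 power2_eq_square)
  then have "U \<noteq> 0" by auto
  ultimately have "T oo (fps_X * h) = fps_X" by (simp add: Y_def f_def)
  then have "of_nat n * fps_nth T n = fps_nth (g ^ n) (n - 1)" if "n > 0" for n
    using lagrange_inversion hg that by blast
  moreover have "g * (1 - qvar * w * ia) = 1"
  proof -
    \<comment> \<open>Hence \<open>b / a = 1 - q * w / a\<close>, which makes
      \<open>g = a / b\<close> a geometric series in \<open>q * w / a\<close>.\<close>
    have "a - qvar * w = b" by (simp add: a_def b_def power2_eq_square algebra_simps)
    then have "1 - qvar * w * ia = ia * b"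
      using ia by (metis mult.commute right_diff_distrib')
    then have "g * (1 - qvar * w * ia) = (ia * a) * (ib * b)" by (simp only: g_def mult_ac)
    then show ?thesis by (simp only: ia ib mult_1)
  qed
  ultimately show ?thesis using that[of ia g] ia unfolding a_def w_def by blast
qed

lemma G_summand_suminf_nth:
  "fps_nth (\<Sum>i. G_summand (Suc i)) n = (\<Sum>i<n. fps_nth (G_summand (Suc i)) n)"
proof -
  have "eventually (\<lambda>m. fps_nth (\<Sum>i<m. G_summand (Suc i)) k =
          fps_nth (\<Sum>i<k. G_summand (Suc i)) k) sequentially" for k
    by (rule eventually_sequentiallyI[of k], simp add: fps_sum_nth, rule sum.mono_neutral_right)
       (auto simp: G_summand_altdef)
  then have "(\<lambda>i. G_summand (Suc i)) sums Abs_fps (\<lambda>n. fps_nth (\<Sum>i<n. G_summand (Suc i)) n)"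
    unfolding sums_def by (intro tendsto_fpsI) simp
  then show ?thesis by (simp add: sums_unique[symmetric] fps_sum_nth)
qed


lemma const_X2_power_nth:
  "fps_nth ((fps_const d * fps_X\<^sup>2) ^ t) m = (if m = 2 * t then d ^ t else 0)" for d :: "'a::comm_ring_1"
  by (simp add: power_mult_distrib fps_const_power flip: power_mult)

text \<open>The outer expansion of \<open>g\<close> in powers of \<open>z\<close> gives the first
  binomial coefficient, the inner expansion of \<open>c ^ j\<close> the second one. Only even powers
  of \<open>fps_X\<close> occur in \<open>g\<close>, hence only odd ones in
  \<open>T\<close>.\<close>

lemma tree_series_nth:
  fixes T :: "rat poly fps"
  assumes T0: "fps_nth T 0 = 0"
    and T: "(T - fps_X) * (1 - qvar\<^sup>2 * T\<^sup>2) = qvar * T ^ 3"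
  shows "fps_nth T (2 * i) = 0"
    and "of_nat (2 * i + 1) * fps_nth T (2 * i + 1) = (if i = 0 then 1 else
      (\<Sum>j=1..i. monom (of_nat ((2 * i + j) choose j) * of_nat ((i - 1) choose (j - 1))) (2 * i - j)))"
proof -
  obtain g c where c: "c * (1 - qvar\<^sup>2 * fps_X\<^sup>2) = 1" and g: "g * (1 - qvar * fps_X\<^sup>2 * c) = 1"
    and Tn: "\<And>n. n > 0 \<Longrightarrow> of_nat n * fps_nth T n = fps_nth (g ^ n) (n - 1)"
    using tree_series_lagrange[OF T0 T] by blast
  define z where "z = qvar * fps_X\<^sup>2 * c"
  have c_nth: "fps_nth (c ^ Suc l) m
      = (if even m then monom (of_nat ((l + m div 2) choose l)) m else 0)" for l m
  proof -
    have "fps_nth (c ^ Suc l) m = (\<Sum>t\<le>m. of_nat ((l + t) choose t) * fps_nth ((qvar\<^sup>2 * fps_X\<^sup>2) ^ t) m)"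
      by (rule geometric_power_nth[OF c]) (simp add: power2_eq_square)
    also have "\<dots> = (\<Sum>t\<le>m. if m = 2 * t then of_nat ((l + t) choose t) * monom 1 m else 0)"
      unfolding qvar_power const_X2_power_nth monom_power by (intro sum.cong refl) simp
    also have "\<dots> = (if even m then of_nat ((l + m div 2) choose l) * monom 1 m else 0)"
    proof (cases "even m")
      case True
      then obtain s where s: "m = 2 * s" by (elim evenE)
      then have "(\<Sum>t\<le>m. if m = 2 * t then of_nat ((l + t) choose t) * monom (1::rat) m else 0)
         = (\<Sum>t\<le>m. if t = s then of_nat ((l + t) choose t) * monom 1 m else 0)"
        by (intro sum.cong refl) simp
      then show ?thesis using s by (simp add: binomial_symmetric[of s "l + s"])
    qed (auto intro!: sum.neutral)
    also have "of_nat ((l + m div 2) choose l) * monom (1::rat) m = monom (of_nat ((l + m div 2) choose l)) m"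
      by (simp add: of_nat_poly smult_monom)
    finally show ?thesis .
  qed
  have z_nth: "fps_nth (z ^ j) m = (if even m \<and> 2 * j \<le> m
      then monom (of_nat ((m div 2 - 1) choose (j - 1))) (m - j) else 0)" if j: "j > 0" for j m
  proof -
    obtain l where l: "j = Suc l" using j gr0_conv_Suc by auto
    have "z ^ j = fps_const (monom 1 j) * (fps_X ^ (2 * j) * c ^ j)"
      by (simp only: z_def power_mult_distrib qvar_power power_mult mult.assoc)
    then have "fps_nth (z ^ j) m = (if m < 2 * j then 0 else monom 1 j * fps_nth (c ^ j) (m - 2 * j))"
      by (simp add: fps_X_power_mult_nth)
    moreover have "monom 1 j * fps_nth (c ^ j) (m - 2 * j)
        = (if even m then monom (of_nat ((m div 2 - 1) choose (j - 1))) (m - j) else 0)" if "2 * j \<le> m"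
    proof -
      have "l + (m - 2 * Suc l) div 2 = m div 2 - 1" if "even m"
        using that \<open>2 * j \<le> m\<close> l by (elim evenE) simp
      moreover have "j + (m - 2 * j) = m - j" using that by simp
      ultimately show ?thesis
        using c_nth[of l "m - 2 * j"] that by (simp add: l mult_monom del: power_Suc)
    qed
    ultimately show ?thesis by auto
  qed
  have g_nth: "fps_nth (g ^ Suc n) m = (\<Sum>j\<le>m. of_nat ((n + j) choose j) * fps_nth (z ^ j) m)" for n m
    using geometric_power_nth[of g z n m] g by (simp add: z_def)
  \<comment> \<open>The term \<open>j = 0\<close> is the constant series 1 and disappears in
    positive degree; the formula for \<open>z ^ j\<close> holds only for
    \<open>j > 0\<close>.\<close>
  have g_nth': "fps_nth (g ^ Suc n) m = (\<Sum>j=1..m. of_nat ((n + j) choose j) * fps_nth (z ^ j) m)"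
    if "m > 0" for n m
  proof -
    have "{..m} = insert 0 {1..m}" by auto
    then show ?thesis unfolding g_nth using that by simp
  qed
  show "fps_nth T (2 * i) = 0"
  proof (cases "i = 0")
    case False
    then have "of_nat (2 * i) * fps_nth T (2 * i) = fps_nth (g ^ Suc (2 * i - 1)) (2 * i - 1)"
      using Tn[of "2 * i"] by simp
    also have "\<dots> = 0" using False by (subst g_nth') (auto intro!: sum.neutral simp: z_nth)
    finally show ?thesis using False by (simp del: of_nat_mult)
  qed (simp add: T0)
  show "of_nat (2 * i + 1) * fps_nth T (2 * i + 1) = (if i = 0 then 1 else
      (\<Sum>j=1..i. monom (of_nat ((2 * i + j) choose j) * of_nat ((i - 1) choose (j - 1))) (2 * i - j)))"
  proof (cases "i = 0")
    case True
    then show ?thesis using Tn[of 1] g_nth[of 0 0] by simp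
  next
    case False
    have "of_nat (2 * i + 1) * fps_nth T (2 * i + 1) = fps_nth (g ^ Suc (2 * i)) (2 * i)"
      using Tn[of "2 * i + 1"] by simp
    also have "\<dots> = (\<Sum>j=1..2 * i. of_nat ((2 * i + j) choose j) * fps_nth (z ^ j) (2 * i))"
      using False by (intro g_nth') simp
    also have "\<dots> = (\<Sum>j=1..i. of_nat ((2 * i + j) choose j) * fps_nth (z ^ j) (2 * i))"
      by (intro sum.mono_neutral_right) (auto simp: z_nth)
    also have "\<dots> = (\<Sum>j=1..i. monom (of_nat ((2 * i + j) choose j) * of_nat ((i - 1) choose (j - 1))) (2 * i - j))"
      by (intro sum.cong refl) (auto simp: z_nth of_nat_poly smult_monom)
    finally show ?thesis using False by simp
  qed
qed

text \<open>Reconciles the factor \<open>1 / (2*i + 1)\<close> produced by Lagrange inversion with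
  the factor \<open>1 / i\<close> of the given series, by applying the absorption identity to both
  binomial coefficients.\<close>

lemma lagrange_choose_identity:
  assumes "1 \<le> j"
  shows "(2 * i + 1) * ((2 * i + j) choose (2 * i + 1)) * (i choose j)
       = i * (((2 * i + j) choose j) * ((i - 1) choose (j - 1)))"
proof -
  obtain l where l: "j = Suc l" using assms by (cases j) auto
  have "(2 * i + 1) * ((2 * i + j) choose (2 * i + 1)) = (2 * i + j) * ((2 * i + l) choose (2 * i))"
    using binomial_absorption[of "2 * i" "2 * i + j"] by (simp add: l)
  also have "(2 * i + l) choose (2 * i) = (2 * i + l) choose l"
    using binomial_symmetric[of l "2 * i + l"] by simp
  also have "(2 * i + j) * ((2 * i + l) choose l) = j * ((2 * i + j) choose j)"
    using binomial_absorption[of l "2 * i + j"] by (simp add: l)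
  finally have "(2 * i + 1) * ((2 * i + j) choose (2 * i + 1)) * (i choose j)
      = ((2 * i + j) choose j) * (j * (i choose j))" by (simp only: mult_ac)
  also have "j * (i choose j) = i * ((i - 1) choose (j - 1))"
    using binomial_absorption[of l i] by (simp add: l)
  finally show ?thesis by (simp only: mult_ac)
qed

lemma G_summand_nth:
  "fps_nth (G_summand i) n = (if n = 2 * i then (\<Sum>j=1..i.
     monom (1 / of_nat i * of_nat ((2*i + j) choose (2*i + 1)) * of_nat (i choose j)) (2*i - j)) else 0)"
  by (simp add: G_summand_altdef)

lemma G_tree_eq_X_times_tree_series:
  fixes T :: "rat poly fps"
  assumes T0: "fps_nth T 0 = 0"
    and T: "(T - fps_X) * (1 - qvar\<^sup>2 * T\<^sup>2) = qvar * T ^ 3"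
  shows "G_tree = fps_X * T"
proof (rule fps_ext)
  fix n
  have S: "fps_nth (\<Sum>i. G_summand (Suc i)) m = (if even m \<and> m > 0 then fps_nth (G_summand (m div 2)) m else 0)" for m
  proof (cases "even m \<and> m > 0")
    case True
    then obtain i where i: "m = 2 * Suc i" by (metis dvdE gr0_conv_Suc mult_0_right neq0_conv)
    have "(\<Sum>k<m. fps_nth (G_summand (Suc k)) m) = (\<Sum>k<m. if k = i then fps_nth (G_summand (Suc k)) m else 0)"
      by (intro sum.cong refl) (simp add: G_summand_nth i)
    then show ?thesis using True i by (simp add: G_summand_suminf_nth)
  qed (auto simp: G_summand_suminf_nth G_summand_nth intro!: sum.neutral)
  have G: "fps_nth G_tree n = (if n < 2 then 0 else fps_nth (1 + (\<Sum>i. G_summand (Suc i))) (n - 2))" for n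
    by (simp add: G_tree_def xvar_def fps_X_power_mult_nth)
  consider "n = 0" | i where "n = Suc (2 * i)" | i where "n = Suc (2 * i + 1)"
    by (metis One_nat_def Suc_eq_plus1 evenE not0_implies_Suc oddE)
  then show "fps_nth G_tree n = fps_nth (fps_X * T) n"
  proof cases
    case 1
    then show ?thesis by (simp add: G)
  next
    case 2
    then show ?thesis using tree_series_nth(1)[OF T0 T, of i]
      by (cases i) (auto simp: G S)
  next
    case (3 i)
    show ?thesis
    proof (cases "i = 0")
      case True
      then show ?thesis using 3 tree_series_nth(2)[OF T0 T, of 0] by (simp add: G S)
    next
      case False
      \<comment> \<open>Both coefficients are compared after multiplication by
        \<open>2*i + 1\<close>, since there is no division in the polynomial ring; the factor is
        cancelled at the end.\<close>
      have "of_nat (2 * i + 1) * fps_nth G_tree n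
          = (\<Sum>j=1..i. of_nat (2 * i + 1) * monom (1 / of_nat i * of_nat ((2*i + j) choose (2*i + 1)) * of_nat (i choose j) :: rat) (2*i - j))"
        using False 3 by (simp add: G S G_summand_nth sum_distrib_left del: of_nat_add of_nat_mult of_nat_Suc)
      also have "\<dots> = (\<Sum>j=1..i. monom (of_nat ((2 * i + j) choose j) * of_nat ((i - 1) choose (j - 1))) (2 * i - j))"
      proof (intro sum.cong refl)
        fix j assume j: "j \<in> {1..i}"
        have cancel: "r * (1 / s * A * B) = C * E" if "r * A * B = s * (C * E)" "s \<noteq> 0" for r s A B C E :: rat
          using that by (simp add: field_simps)
        have "(of_nat ((2 * i + 1) * ((2 * i + j) choose (2 * i + 1)) * (i choose j)) :: rat)
            = of_nat (i * (((2 * i + j) choose j) * ((i - 1) choose (j - 1))))"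
          using lagrange_choose_identity[of j i] j by (simp only: atLeastAtMost_iff)
        then have "of_nat (2 * i + 1) * (1 / of_nat i * of_nat ((2*i + j) choose (2*i + 1)) * of_nat (i choose j) :: rat)
            = of_nat ((2 * i + j) choose j) * of_nat ((i - 1) choose (j - 1))"
          using False by (intro cancel) (simp_all only: of_nat_mult of_nat_eq_0_iff not_False_eq_True)
        then show "of_nat (2 * i + 1) * monom (1 / of_nat i * of_nat ((2*i + j) choose (2*i + 1)) * of_nat (i choose j) :: rat) (2*i - j)
          = monom (of_nat ((2 * i + j) choose j) * of_nat ((i - 1) choose (j - 1))) (2 * i - j)"
          by (simp only: of_nat_poly smult_monom mult_pCons_left mult_zero_left pCons_0_0 add_0_right)
      qed
      also have "\<dots> = of_nat (2 * i + 1) * fps_nth (fps_X * T) n"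
        using tree_series_nth(2)[OF T0 T, of i] False 3 by simp
      finally show ?thesis
        by (simp only: mult_cancel_left of_nat_eq_0_iff) simp
    qed
  qed
qed

text \<open>With \<open>G_tree = fps_X * T\<close> the cubic is \<open>fps_X ^ 3\<close> times the
  defining equation of \<open>T\<close>.\<close>

lemma G_tree_cubic:
  fixes T :: "rat poly fps"
  assumes T0: "fps_nth T 0 = 0"
    and T: "(T - fps_X) * (1 - qvar\<^sup>2 * T\<^sup>2) = qvar * T ^ 3"
  shows "qvar * (qvar + 1) * G_tree ^ 3 - qvar\<^sup>2 * xvar\<^sup>2 * G_tree\<^sup>2 - xvar\<^sup>2 * G_tree + xvar ^ 4 = 0"
proof -
  have "qvar * (qvar + 1) * G_tree ^ 3 - qvar\<^sup>2 * xvar\<^sup>2 * G_tree\<^sup>2 - xvar\<^sup>2 * G_tree + xvar ^ 4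
     = fps_X ^ 3 * (qvar * T ^ 3 - (T - fps_X) * (1 - qvar\<^sup>2 * T\<^sup>2))"
    unfolding G_tree_eq_X_times_tree_series[OF T0 T] xvar_def
    by (simp add: algebra_simps power2_eq_square power3_eq_cube power4_eq_xxxx)
  then show ?thesis by (simp add: T)
qed


text \<open>
  Since \<open>x = N(T) / D(T)\<close> with \<open>N = u - q (q + 1) u\<^sup>3\<close> and \<open>D = 1 - q\<^sup>2 u\<^sup>2\<close>, a quadratic relation for
  \<open>T\<close> over \<open>\<rat>(q, x)\<close> becomes a polynomial identity in \<open>u\<close> over \<open>\<rat>[q]\<close>.  Its top term in \<open>N\<close> vanishes
  at the two zeros of \<open>D\<close>, which leaves no room for a quadratic polynomial other than a multiple of
  \<open>D\<close>, and the degree in \<open>u\<close> excludes the latter.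
\<close>

lemma tree_series_not_quadratic:
  fixes T :: "rat poly fps" and a b c :: "rat poly poly"
  assumes T0: "fps_nth T 0 = 0"
    and T: "(T - fps_X) * (1 - qvar\<^sup>2 * T\<^sup>2) = qvar * T ^ 3"
    and rel: "fps_of_poly a * T\<^sup>2 + fps_of_poly b * T + fps_of_poly c = 0"
  shows "a = 0 \<and> b = 0 \<and> c = 0"
proof (rule ccontr)
  assume nz: "\<not> ?thesis"
  define d where "d = max (degree a) (max (degree b) (degree c))"
  define q :: "rat poly" where "q = [:0, 1:]"
  define N where "N = [:0, 1, 0, - q * (q + 1):]"
  define D where "D = [:1, 0, - q\<^sup>2:]"
  define Q where "Q i = [:coeff c i, coeff b i, coeff a i:]" for i
  \<comment> \<open>The relation at \<open>x = N / D\<close>, cleared of denominators by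
    \<open>D ^ d\<close>; \<open>Q i\<close> collects the coefficients of
    \<open>x ^ i\<close>.\<close>
  define P where "P = (\<Sum>i\<le>d. Q i * N ^ i * D ^ (d - i))"
  have q0: "q \<noteq> 0" and q1: "q + 1 \<noteq> 0" by (simp_all add: q_def one_pCons)
  have Tnz: "T \<noteq> 0"
  proof
    assume "T = 0"
    then show False using T by simp
  qed
  let ?ev = "\<lambda>p. fps_of_poly p oo T"
  have ev_mult: "?ev (p * r) = ?ev p * ?ev r" and ev_power: "?ev (p ^ n) = ?ev p ^ n" for p r n
    by (simp_all add: fps_of_poly_mult fps_of_poly_power fps_compose_mult_distrib T0 fps_compose_power)
  have ev_sum: "?ev (sum f A) = (\<Sum>i\<in>A. ?ev (f i))" for f :: "nat \<Rightarrow> rat poly poly" and A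
    by (simp add: fps_of_poly_sum fps_compose_sum_distrib)
  have ev_pCons: "?ev (pCons e p) = fps_const e + T * ?ev p" for e p
    by (simp add: fps_of_poly_pCons fps_compose_add_distrib fps_compose_mult_distrib T0
        fps_X_fps_compose_startby0 mult.commute)
  have qv: "qvar = fps_const q" by (simp add: qvar_def q_def)
  have qq: "fps_const (- q * (q + 1)) = - (qvar * (qvar + 1))"
    by (simp add: qv flip: fps_const_add fps_const_mult fps_const_neg)
  have ev_N: "?ev N = T - qvar * (qvar + 1) * T ^ 3"
    unfolding N_def ev_pCons qq by (simp add: power3_eq_cube algebra_simps)
  have ev_D: "?ev D = 1 - qvar\<^sup>2 * T\<^sup>2"
    by (simp add: D_def ev_pCons qv power2_eq_square algebra_simps flip: fps_const_neg fps_const_mult)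
  have ND: "?ev N = fps_X * ?ev D"
    using T unfolding ev_N ev_D by (simp add: algebra_simps power2_eq_square power3_eq_cube)
  have ev_Q: "?ev (Q i) = fps_const (coeff a i) * T\<^sup>2 + fps_const (coeff b i) * T + fps_const (coeff c i)" for i
    by (simp add: Q_def ev_pCons power2_eq_square algebra_simps)
  have expand: "fps_of_poly p = (\<Sum>i\<le>d. fps_const (coeff p i) * fps_X ^ i)" if "degree p \<le> d" for p :: "rat poly poly"
    using that by (intro fps_ext) (auto simp: fps_sum_nth coeff_eq_0 if_distrib cong: if_cong)
  have "?ev P = (\<Sum>i\<le>d. ?ev (Q i) * fps_X ^ i * (?ev D ^ i * ?ev D ^ (d - i)))"
    unfolding P_def ev_sum by (intro sum.cong refl) (simp add: ev_mult ev_power ND power_mult_distrib mult_ac)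
  also have "\<dots> = (\<Sum>i\<le>d. ?ev (Q i) * fps_X ^ i * ?ev D ^ d)"
    by (intro sum.cong refl) (simp flip: power_add)
  also have "\<dots> = (fps_of_poly a * T\<^sup>2 + fps_of_poly b * T + fps_of_poly c) * ?ev D ^ d"
  proof -
    have "degree a \<le> d" "degree b \<le> d" "degree c \<le> d" by (simp_all add: d_def)
    note e = this[THEN expand]
    show ?thesis
      unfolding e ev_Q sum_distrib_right sum.distrib[symmetric]
      by (intro sum.cong refl) (simp only: algebra_simps)
  qed
  finally have "fps_of_poly P oo T = 0" by (simp add: rel)
  \<comment> \<open>\<open>T\<close> is nonzero without constant term, so evaluation of a polynomial
    at \<open>T\<close> is injective.\<close>
  then have P0: "P = 0"
    using Tnz by (simp add: fps_compose_eq_0_iff T0)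

  define e where "e = to_fract q"
  have e0: "e \<noteq> 0" using q0 by (simp add: e_def)
  define F where "F p t = poly (fract_poly p) t" for p :: "rat poly poly" and t
  have F_mult: "F (p * r) t = F p t * F r t" for p r t
    by (simp add: F_def)
  have F_power: "F (p ^ n) t = F p t ^ n" for p n t
    by (induction n) (simp_all add: F_mult, simp add: F_def)
  have F_sum: "F (sum f A) t = (\<Sum>i\<in>A. F (f i) t)" for f :: "nat \<Rightarrow> rat poly poly" and A t
    by (induction A rule: infinite_finite_induct) (simp_all add: F_def)
  \<comment> \<open>At \<open>t = 1/q\<close> and \<open>t = -1/q\<close> the polynomial
    \<open>D\<close> vanishes while \<open>N\<close> takes the nonzero value \<open>- t / q\<close>,
    so only the summand \<open>i = d\<close> of \<open>P\<close> survives.\<close>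
  have root: "F (Q d) t = 0" if t: "t = 1 / e \<or> t = - 1 / e" for t
  proof -
    have "e\<^sup>2 * t\<^sup>2 = 1" using t e0 by (auto simp: power_divide)
    then have FD: "F D t = 0"
      by (simp add: F_def D_def e_def map_poly_pCons power2_eq_square algebra_simps)
    have FN: "F N t = - t / e"
    proof -
      have "F N t = t - e * (e + 1) * (t * t\<^sup>2)"
        by (simp add: F_def N_def e_def map_poly_pCons algebra_simps power2_eq_square)
      also have "t\<^sup>2 = 1 / e\<^sup>2" using t by (auto simp: power_divide)
      also have "t - e * (e + 1) * (t * (1 / e\<^sup>2)) = - t / e"
        using e0 by (simp add: field_simps power2_eq_square)
      finally show ?thesis .
    qed
    have "F P t = (\<Sum>i\<le>d. F (Q i) t * F N t ^ i * F D t ^ (d - i))"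
      unfolding P_def F_sum F_mult F_power ..
    also have "\<dots> = (\<Sum>i\<le>d. if i = d then F (Q d) t * F N t ^ d else 0)"
      by (intro sum.cong refl) (simp add: FD)
    finally have "F (Q d) t * F N t ^ d = 0" by (simp add: P0 F_def)
    moreover have "F N t \<noteq> 0" using t e0 by (auto simp: FN)
    ultimately show ?thesis by simp
  qed
  have quad: "to_fract (coeff c d) + t * to_fract (coeff b d) + t\<^sup>2 * to_fract (coeff a d) = 0"
    if "t = 1 / e \<or> t = - 1 / e" for t
    using root[OF that] by (simp add: F_def Q_def map_poly_pCons algebra_simps power2_eq_square)
  \<comment> \<open>Otherwise the summand \<open>i = d\<close> has degree \<open>3*d + 2\<close>,
    while each other one has degree at most \<open>2 + 3*i + 2*(d - i)\<close>, which is at most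
    \<open>3*d + 1\<close>: it cannot be cancelled.\<close>
  have a_zero: "coeff a d = 0"
  proof (rule ccontr)
    assume a: "coeff a d \<noteq> 0"
    have dN: "degree N = 3" and dD: "degree D = 2"
      using q0 q1 by (simp_all add: N_def D_def)
    have dQ: "degree (Q d) = 2" using a by (simp add: Q_def)
    have nonzero: "Q d \<noteq> 0" "N \<noteq> 0" using a by (auto simp: Q_def N_def)
    define R where "R = (\<Sum>i<d. Q i * N ^ i * D ^ (d - i))"
    have "P = R + Q d * N ^ d" by (simp add: P_def R_def flip: lessThan_Suc_atMost)
    then have "Q d * N ^ d = - R" using P0 by (simp add: eq_neg_iff_add_eq_0 add.commute)
    then have "degree (Q d * N ^ d) = degree R" by simp
    moreover have "degree (Q d * N ^ d) = 3 * d + 2"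
      using nonzero by (simp add: degree_mult_eq degree_power_eq dQ dN)
    moreover have "degree R \<le> 3 * d + 1"
      unfolding R_def
    proof (intro degree_sum_le)
      fix i assume "i \<in> {..<d}"
      then have i: "i < d" by simp
      have "degree (Q i * N ^ i * D ^ (d - i)) \<le> degree (Q i) + degree (N ^ i) + degree (D ^ (d - i))"
        by (meson add_le_mono degree_mult_le le_refl order_trans)
      moreover have "degree (N ^ i) \<le> 3 * i" "degree (D ^ (d - i)) \<le> 2 * (d - i)"
        using degree_power_le[of N i] degree_power_le[of D "d - i"] by (simp_all add: dN dD)
      moreover have "degree (Q i) \<le> 2" by (simp add: Q_def degree_pCons_eq_if)
      ultimately show "degree (Q i * N ^ i * D ^ (d - i)) \<le> 3 * d + 1" using i by linarith
    qed simp
    ultimately show False by simp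
  qed
  \<comment> \<open>Now \<open>Q d\<close> has degree at most 1 but two distinct roots. All three
    coefficients at \<open>d\<close> vanish, against the choice of \<open>d\<close> as the maximal
    degree.\<close>
  have "to_fract (coeff b d) = 0"
    using quad[of "1 / e"] quad[of "- 1 / e"] e0 by (simp add: a_zero field_simps)
  moreover from this have "to_fract (coeff c d) = 0"
    using quad[of "1 / e"] by (simp add: a_zero)
  ultimately have bc: "coeff b d = 0" "coeff c d = 0" by simp_all
  have "d = degree a \<or> d = degree b \<or> d = degree c" by (auto simp: d_def max_def)
  show False
  proof (cases "d = 0")
    case True
    then have "degree a = 0" "degree b = 0" "degree c = 0" by (simp_all add: d_def)
    then show False using nz a_zero bc True by (metis leading_coeff_0_iff)
  next
    case False
    from \<open>d = degree a \<or> d = degree b \<or> d = degree c\<close> a_zero bc have "d = 0"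
      by (metis degree_0 leading_coeff_0_iff)
    with False show False by simp
  qed
qed

section \<open>The algebraic degree over the rational functions\<close>

lemma to_laurent_add: "to_laurent (F + G) = to_laurent F + to_laurent G"
  and to_laurent_mult: "to_laurent (F * G) = to_laurent F * to_laurent G"
  and to_laurent_0: "to_laurent 0 = 0" and to_laurent_1: "to_laurent 1 = 1"
  and to_laurent_eq_0_iff: "to_laurent F = 0 \<longleftrightarrow> F = 0"
proof -
  let ?f = "\<lambda>F :: rat poly fps. Abs_fps (\<lambda>n. to_fract (fps_nth F n))"
  have "?f (F + G) = ?f F + ?f G" "?f (F * G) = ?f F * ?f G"
    "?f 0 = 0" "?f 1 = 1" by (simp_all add: fps_eq_iff fps_mult_nth)
  then show "to_laurent (F + G) = to_laurent F + to_laurent G"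
    "to_laurent (F * G) = to_laurent F * to_laurent G" "to_laurent 0 = 0" "to_laurent 1 = 1"
    by (simp_all add: to_laurent_def fps_to_fls_plus fls_times_fps_to_fls)
  show "to_laurent F = 0 \<longleftrightarrow> F = 0"
    by (simp add: to_laurent_def fps_eq_iff)
qed

lemma to_laurent_power: "to_laurent (F ^ n) = to_laurent F ^ n"
  by (induction n) (simp_all add: to_laurent_1 to_laurent_mult)

lemma fps_of_poly_eq_0_iff: "fps_of_poly p = 0 \<longleftrightarrow> p = 0"
  using fps_of_poly_eq_iff[of p 0] by simp

text \<open>The cubic divided by \<open>q * (q + 1)\<close> is a monic annihilator. A polynomial of
  smaller degree would, after clearing denominators, give a quadratic relation for \<open>T\<close>
  with polynomial coefficients.\<close>

lemma tree_series_G_algebraic_of_degree_3: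
  fixes T :: "rat poly fps"
  assumes T0: "fps_nth T 0 = 0"
    and T: "(T - fps_X) * (1 - qvar\<^sup>2 * T\<^sup>2) = qvar * T ^ 3"
  shows "algebraic_of_degree rational_functions (to_laurent G_tree) 3"
  unfolding algebraic_of_degree_def
proof (intro conjI allI impI)
  let ?L = "\<lambda>p. to_laurent (fps_of_poly p)"
  let ?G = "to_laurent G_tree"
  define q :: "rat poly poly" where "q = [:[:0, 1:]:]"
  define x :: "rat poly poly" where "x = [:0, 1:]"
  have qx: "qvar = fps_of_poly q" "xvar = fps_of_poly x"
    by (simp_all add: q_def x_def qvar_def xvar_def fps_of_poly_const fps_of_poly_pCons)
  have q0: "q * (q + 1) \<noteq> 0" by (simp add: q_def one_pCons)
  have in_K: "?L a / ?L b \<in> rational_functions" if "b \<noteq> 0" for a b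
    using that by (auto simp: rational_functions_def)
  let ?k = "?L (q * (q + 1))"
  have k0: "?k \<noteq> 0" using q0 by (simp add: to_laurent_eq_0_iff fps_of_poly_eq_0_iff)
  \<comment> \<open>Each nonzero coefficient, including the leading 1, is written as a quotient so
    that it visibly lies in \<open>rational_functions\<close>.\<close>
  let ?p = "[:?L (x ^ 4) / ?k, ?L (- x\<^sup>2) / ?k, ?L (- (q\<^sup>2 * x\<^sup>2)) / ?k, ?L 1 / ?L 1:]"
  show "\<exists>p. lead_coeff p = 1 \<and> degree p = 3 \<and> (\<forall>i. coeff p i \<in> rational_functions) \<and> poly p ?G = 0"
  proof (intro exI[of _ ?p] conjI allI)
    show "lead_coeff ?p = 1" "degree ?p = 3" by (simp_all add: to_laurent_1)
    show "coeff ?p i \<in> rational_functions" for i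
      using in_K[OF q0] in_K[of 1 1] in_K[of 1 0]
      by (auto simp: coeff_pCons to_laurent_0 to_laurent_1 split: nat.splits)
    have "?k * poly ?p ?G = to_laurent (qvar * (qvar + 1) * G_tree ^ 3 - qvar\<^sup>2 * xvar\<^sup>2 * G_tree\<^sup>2
        - xvar\<^sup>2 * G_tree + xvar ^ 4)"
    proof -
      have "?k * poly ?p ?G = ?L (x ^ 4) + ?L (- x\<^sup>2) * ?G + ?L (- (q\<^sup>2 * x\<^sup>2)) * ?G\<^sup>2 + ?k * ?G ^ 3"
        using k0 by (simp add: to_laurent_1 field_simps power2_eq_square power3_eq_cube)
      also have "\<dots> = to_laurent (fps_of_poly (x ^ 4) + fps_of_poly (- x\<^sup>2) * G_tree
          + fps_of_poly (- (q\<^sup>2 * x\<^sup>2)) * G_tree\<^sup>2 + fps_of_poly (q * (q + 1)) * G_tree ^ 3)"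
        by (simp only: to_laurent_add to_laurent_mult to_laurent_power)
      also have "fps_of_poly (x ^ 4) + fps_of_poly (- x\<^sup>2) * G_tree
          + fps_of_poly (- (q\<^sup>2 * x\<^sup>2)) * G_tree\<^sup>2 + fps_of_poly (q * (q + 1)) * G_tree ^ 3
        = qvar * (qvar + 1) * G_tree ^ 3 - qvar\<^sup>2 * xvar\<^sup>2 * G_tree\<^sup>2 - xvar\<^sup>2 * G_tree + xvar ^ 4"
        by (simp add: qx fps_of_poly_mult fps_of_poly_power fps_of_poly_add fps_of_poly_uminus)
      finally show ?thesis .
    qed
    then show "poly ?p ?G = 0" using k0 G_tree_cubic[OF T0 T] by (simp add: to_laurent_0)
  qed
next
  fix p
  let ?L = "\<lambda>p. to_laurent (fps_of_poly p)"
  let ?G = "to_laurent G_tree"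
  assume p: "p \<noteq> 0 \<and> (\<forall>i. coeff p i \<in> rational_functions) \<and> poly p ?G = 0"
  show "3 \<le> degree p"
  proof (rule ccontr)
    assume "\<not> 3 \<le> degree p"
    then have deg: "degree p \<le> 2" by simp
    have "\<exists>a b. coeff p i = ?L a / ?L b \<and> b \<noteq> 0" for i
      using p by (auto simp: rational_functions_def)
    then obtain a b where ab: "\<And>i. coeff p i = ?L (a i) / ?L (b i)" "\<And>i. b i \<noteq> 0" by metis
    have b0: "?L (b i) \<noteq> 0" for i using ab(2) by (simp add: to_laurent_eq_0_iff fps_of_poly_eq_0_iff)
    have ev: "poly p ?G = coeff p 0 + coeff p 1 * ?G + coeff p 2 * ?G\<^sup>2"
    proof -
      have "p = [:coeff p 0, coeff p 1, coeff p 2:]"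
        using deg by (intro poly_eqI) (auto simp: coeff_pCons numeral_2_eq_2 intro!: coeff_eq_0 split: nat.splits)
      then have "poly p ?G = poly [:coeff p 0, coeff p 1, coeff p 2:] ?G" by simp
      then show ?thesis by (simp add: power2_eq_square algebra_simps)
    qed
    define x :: "rat poly poly" where "x = [:0, 1:]"
    have x: "fps_X = fps_of_poly x" by (simp add: x_def fps_of_poly_pCons)
    \<comment> \<open>Common denominators are cleared; the powers of \<open>x\<close> come from
      \<open>G_tree = fps_X * T\<close>.\<close>
    define A where "A = a 2 * b 0 * b 1 * x\<^sup>2"
    define B where "B = a 1 * b 0 * b 2 * x"
    define C where "C = a 0 * b 1 * b 2"
    have "to_laurent (fps_of_poly A * T\<^sup>2 + fps_of_poly B * T + fps_of_poly C)
        = ?L (b 0) * ?L (b 1) * ?L (b 2) * poly p ?G"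
      unfolding ev unfolding G_tree_eq_X_times_tree_series[OF T0 T] using b0[of 0] b0[of 1] b0[of 2]
      by (simp add: ab A_def B_def C_def x to_laurent_add to_laurent_mult to_laurent_power
          fps_of_poly_mult fps_of_poly_power field_simps)
    then have "fps_of_poly A * T\<^sup>2 + fps_of_poly B * T + fps_of_poly C = 0"
      using p by (simp add: to_laurent_eq_0_iff)
    then have "A = 0 \<and> B = 0 \<and> C = 0" by (rule tree_series_not_quadratic[OF T0 T])
    then have "a 0 = 0" "a 1 = 0" "a 2 = 0" using ab(2) by (auto simp: A_def B_def C_def x_def)
    then have "coeff p i = 0" if "i \<le> 2" for i
      using that ab(1)[of i] by (auto simp: le_Suc_eq numeral_2_eq_2 to_laurent_0)
    then have "p = 0" using deg by (metis leading_coeff_0_iff)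
    with p show False by simp
  qed
qed

section \<open>Counting plane trees\<close>

text \<open>\<open>x\<close> marks the size \<open>s\<close> and \<open>q\<close> the weight
  \<open>w\<close>. A sum over an infinite set is 0 by convention, hence the finiteness hypotheses
  in the rules below.\<close>

definition gen_fun :: "('a \<Rightarrow> nat) \<Rightarrow> ('a \<Rightarrow> nat) \<Rightarrow> 'a set \<Rightarrow> rat poly fps" where
  "gen_fun s w A = Abs_fps (\<lambda>n. \<Sum>a\<in>{a \<in> A. s a = n}. monom 1 (w a))"

lemma coeff_gen_fun:
  assumes "finite {a \<in> A. s a = n}"
  shows "coeff (fps_nth (gen_fun s w A) n) r = of_nat (card {a \<in> A. s a = n \<and> w a = r})"
proof -
  have "coeff (fps_nth (gen_fun s w A) n) r = (\<Sum>a\<in>{a \<in> A. s a = n}. if w a = r then 1 else 0)"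
    by (simp add: gen_fun_def coeff_sum)
  also have "\<dots> = of_nat (card {a \<in> {a \<in> A. s a = n}. w a = r})"
    using assms by (simp add: sum.If_cases Int_def)
  finally show ?thesis by (simp add: conj_assoc)
qed

lemma gen_fun_Un:
  assumes "\<And>n. finite {a \<in> A. s a = n}" "\<And>n. finite {a \<in> B. s a = n}" "A \<inter> B = {}"
  shows "gen_fun s w (A \<union> B) = gen_fun s w A + gen_fun s w B"
proof (rule fps_ext)
  fix n
  have "{a \<in> A \<union> B. s a = n} = {a \<in> A. s a = n} \<union> {a \<in> B. s a = n}" by auto
  then show "fps_nth (gen_fun s w (A \<union> B)) n = fps_nth (gen_fun s w A + gen_fun s w B) n"
    using assms by (simp add: gen_fun_def sum.union_disjoint disjoint_iff)
qed

lemma gen_fun_image: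
  assumes "inj_on h A"
  shows "gen_fun s w (h ` A) = gen_fun (s \<circ> h) (w \<circ> h) A"
proof (rule fps_ext)
  fix n
  have "{a \<in> h ` A. s a = n} = h ` {a \<in> A. s (h a) = n}" by auto
  moreover have "inj_on h {a \<in> A. s (h a) = n}" using assms by (auto simp: inj_on_def)
  ultimately show "fps_nth (gen_fun s w (h ` A)) n = fps_nth (gen_fun (s \<circ> h) (w \<circ> h) A) n"
    by (simp add: gen_fun_def sum.reindex)
qed

lemma gen_fun_cong:
  assumes "\<And>a. a \<in> A \<Longrightarrow> s a = s' a" "\<And>a. a \<in> A \<Longrightarrow> w a = w' a"
  shows "gen_fun s w A = gen_fun s' w' A"
proof (rule fps_ext)
  fix n
  have "{a \<in> A. s a = n} = {a \<in> A. s' a = n}" using assms by auto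
  then show "fps_nth (gen_fun s w A) n = fps_nth (gen_fun s' w' A) n"
    using assms by (simp add: gen_fun_def)
qed

lemma gen_fun_add_weight:
  "gen_fun s (\<lambda>a. w a + c) A = qvar ^ c * gen_fun s w A"
proof -
  have "qvar ^ c = fps_const (monom 1 c)"
    by (simp add: qvar_def fps_const_power monom_altdef)
  then show ?thesis
    by (intro fps_ext) (simp add: gen_fun_def sum_distrib_left mult_monom add.commute)
qed

lemma finite_size_times:
  assumes "\<And>n. finite {a \<in> A. s a = n}" "\<And>n. finite {b \<in> B. s' b = n}"
  shows "finite {p \<in> A \<times> B. s (fst p) + s' (snd p) = (n::nat)}"
proof -
  have "{p \<in> A \<times> B. s (fst p) + s' (snd p) = n}
      \<subseteq> (\<Union>i\<le>n. {a \<in> A. s a = i}) \<times> (\<Union>i\<le>n. {b \<in> B. s' b = i})" by auto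
  then show ?thesis by (rule finite_subset) (intro finite_cartesian_product finite_UN_I assms finite_atMost)
qed

lemma gen_fun_times:
  assumes "\<And>n. finite {a \<in> A. s a = n}" "\<And>n. finite {b \<in> B. s' b = n}"
  shows "gen_fun (\<lambda>p. s (fst p) + s' (snd p)) (\<lambda>p. w (fst p) + w' (snd p)) (A \<times> B)
     = gen_fun s w A * gen_fun s' w' B"
proof (rule fps_ext)
  fix n
  let ?S = "{p \<in> A \<times> B. s (fst p) + s' (snd p) = n}"
  have "(\<Sum>p\<in>?S. monom (1::rat) (w (fst p) + w' (snd p)))
      = (\<Sum>i=0..n. \<Sum>p\<in>{p \<in> ?S. s (fst p) = i}. monom 1 (w (fst p) + w' (snd p)))"
    by (rule sum.group[symmetric]) (auto intro: finite_size_times assms)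
  also have "\<dots> = (\<Sum>i=0..n. (\<Sum>a\<in>{a \<in> A. s a = i}. monom 1 (w a)) * (\<Sum>b\<in>{b \<in> B. s' b = n - i}. monom 1 (w' b)))"
  proof (intro sum.cong refl)
    fix i assume "i \<in> {0..n}"
    then have "{p \<in> ?S. s (fst p) = i} = {a \<in> A. s a = i} \<times> {b \<in> B. s' b = n - i}" by auto
    then show "(\<Sum>p\<in>{p \<in> ?S. s (fst p) = i}. monom (1::rat) (w (fst p) + w' (snd p)))
       = (\<Sum>a\<in>{a \<in> A. s a = i}. monom 1 (w a)) * (\<Sum>b\<in>{b \<in> B. s' b = n - i}. monom 1 (w' b))"
      by (simp add: sum_product sum.cartesian_product mult_monom split_beta)
  qed
  finally show "fps_nth (gen_fun (\<lambda>p. s (fst p) + s' (snd p)) (\<lambda>p. w (fst p) + w' (snd p)) (A \<times> B)) n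
     = fps_nth (gen_fun s w A * gen_fun s' w' B) n"
    by (simp add: gen_fun_def fps_mult_nth)
qed

section \<open>Plane trees and their functional equation\<close>

datatype ptree = Leaf | Node (children: "ptree list")
  where "children Leaf = []"

fun leaf_count :: "ptree \<Rightarrow> nat" where
  "leaf_count Leaf = 1"
| "leaf_count (Node ts) = sum_list (map leaf_count ts)"

text \<open>A node with \<open>m\<close> children has degree \<open>m + 1\<close> and contributes \<open>(m + 1) - 3\<close> to the dimension.\<close>

fun dimension :: "ptree \<Rightarrow> nat" where
  "dimension Leaf = 0"
| "dimension (Node ts) = (length ts - 2) + sum_list (map dimension ts)"

fun og_shape :: "ptree \<Rightarrow> bool" where
  "og_shape Leaf \<longleftrightarrow> True"
| "og_shape (Node ts) \<longleftrightarrow> odd (length ts) \<and> 3 \<le> length ts \<and> (\<forall>t\<in>set ts. og_shape t)"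

lemma leaf_count_pos: "og_shape t \<Longrightarrow> 0 < leaf_count t"
proof (induction t)
  case (Node ts)
  then have "hd ts \<in> set ts" by (intro hd_in_set) auto
  moreover have "0 < leaf_count (hd ts)" using Node \<open>hd ts \<in> set ts\<close> by simp
  ultimately show ?case using member_le_sum_list[of "leaf_count (hd ts)" "map leaf_count ts"] by simp
qed simp

lemma length_le_sum_list:
  fixes f :: "'a \<Rightarrow> nat"
  assumes "\<And>x. x \<in> set xs \<Longrightarrow> 0 < f x"
  shows "length xs \<le> sum_list (map f xs)"
  using assms
proof (induction xs)
  case (Cons x xs)
  then have "0 < f x" "length xs \<le> sum_list (map f xs)" by simp_all
  then show ?case by simp
qed simp

lemma leaf_count_child_less:
  assumes "og_shape (Node ts)" "t \<in> set ts"
  shows "leaf_count t < leaf_count (Node ts)"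
proof -
  obtain us vs where ts: "ts = us @ t # vs" using assms(2) by (meson split_list)
  have "length (us @ vs) \<le> sum_list (map leaf_count (us @ vs))"
    using assms(1) leaf_count_pos by (intro length_le_sum_list) (auto simp: ts)
  moreover have "length (us @ vs) > 0" using assms(1) by (auto simp: ts)
  ultimately have "0 < sum_list (map leaf_count (us @ vs))" by linarith
  then show ?thesis by (simp add: ts)
qed

text \<open>Every child has strictly fewer leaves than its parent, because it has siblings and each
  of them has a leaf; and there are at most as many children as leaves.\<close>

lemma finite_og_shape: "finite {t. og_shape t \<and> leaf_count t = n}"
proof (induction n rule: less_induct)
  case (less n)
  let ?S = "\<Union>m<n. {t. og_shape t \<and> leaf_count t = m}"
  have "{t. og_shape t \<and> leaf_count t = n} \<subseteq> insert Leaf (Node ` {ts. set ts \<subseteq> ?S \<and> length ts \<le> n})"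
  proof
    fix t assume "t \<in> {t. og_shape t \<and> leaf_count t = n}"
    then have t: "og_shape t" "leaf_count t = n" by auto
    show "t \<in> insert Leaf (Node ` {ts. set ts \<subseteq> ?S \<and> length ts \<le> n})"
    proof (cases t)
      case (Node ts)
      have "length ts \<le> n"
        using t Node leaf_count_pos length_le_sum_list[of ts leaf_count] by auto
      moreover have "set ts \<subseteq> ?S" using t Node leaf_count_child_less by auto
      ultimately show ?thesis using Node by blast
    qed simp
  qed
  moreover have "finite ?S" using less by (intro finite_UN_I) auto
  then have "finite {ts. set ts \<subseteq> ?S \<and> length ts \<le> n}" by (rule finite_lists_length_le)
  then have "finite (insert Leaf (Node ` {ts. set ts \<subseteq> ?S \<and> length ts \<le> n}))" by simp
  ultimately show ?case by (rule finite_subset)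
qed

definition tree_series :: "rat poly fps" where
  "tree_series = gen_fun leaf_count dimension {t. og_shape t}"

lemma tree_series_nth_0: "fps_nth tree_series 0 = 0"
  using leaf_count_pos by (force simp: tree_series_def gen_fun_def intro!: sum.neutral)

text \<open>Detaching two children turns a node with at least five children into a smaller node.\<close>

lemma tree_series_eq:
  "(tree_series - fps_X) * (1 - qvar\<^sup>2 * tree_series\<^sup>2) = qvar * tree_series ^ 3"
proof -
  define V where "V = {t. og_shape t}"
  define N where "N = V - {Leaf}"
  define h3 where "h3 = (\<lambda>(a, b, c). Node [a, b, c])"
  define h5 where "h5 = (\<lambda>(a, b, t). Node (a # b # children t))"
  let ?gf = "gen_fun leaf_count dimension"
  have fV: "finite {a \<in> V. leaf_count a = n}" for n using finite_og_shape by (simp add: V_def)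
  have fN: "finite {a \<in> N. leaf_count a = n}" for n
    by (rule finite_subset[OF _ fV[of n]]) (auto simp: N_def)
  have inj3: "inj_on h3 (V \<times> V \<times> V)" by (auto simp: h3_def inj_on_def)
  have inj5: "inj_on h5 (V \<times> V \<times> N)"
    by (auto simp: h5_def inj_on_def N_def) (metis ptree.collapse)+
  have N_eq: "N = h3 ` (V \<times> V \<times> V) \<union> h5 ` (V \<times> V \<times> N)"
  proof (intro equalityI subsetI)
    fix t assume "t \<in> N"
    then obtain ts where t: "t = Node ts" "og_shape (Node ts)"
      by (cases t) (auto simp: N_def V_def)
    then obtain a b c us where ts: "ts = a # b # c # us"
      by (cases ts; cases "tl ts"; cases "tl (tl ts)") auto
    show "t \<in> h3 ` (V \<times> V \<times> V) \<union> h5 ` (V \<times> V \<times> N)"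
    proof (cases us)
      case Nil
      then have "t = h3 (a, b, c)" by (simp add: h3_def t ts)
      moreover have "(a, b, c) \<in> V \<times> V \<times> V" using t ts by (auto simp: V_def)
      ultimately show ?thesis by blast
    next
      case (Cons d vs)
      then have "vs \<noteq> []" using t ts by auto
      then have "2 \<le> length (d # vs)" by (cases vs) auto
      then have "og_shape (Node (c # us))" using t ts Cons by auto
      then have "(a, b, Node (c # us)) \<in> V \<times> V \<times> N" using t ts by (auto simp: N_def V_def)
      moreover have "t = h5 (a, b, Node (c # us))" by (simp add: h5_def t ts)
      ultimately show ?thesis by blast
    qed
  next
    fix t assume "t \<in> h3 ` (V \<times> V \<times> V) \<union> h5 ` (V \<times> V \<times> N)"
    then show "t \<in> N"
    proof
      assume "t \<in> h3 ` (V \<times> V \<times> V)"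
      then show ?thesis by (auto simp: h3_def V_def N_def)
    next
      assume "t \<in> h5 ` (V \<times> V \<times> N)"
      then obtain a b u where "a \<in> V" "b \<in> V" "u \<in> N" "t = h5 (a, b, u)" by auto
      then show ?thesis by (cases u) (auto simp: h5_def V_def N_def)
    qed
  qed
  \<comment> \<open>The two kinds of nodes are told apart by their number of children: three, or at
    least five.\<close>
  have disj: "h3 ` (V \<times> V \<times> V) \<inter> h5 ` (V \<times> V \<times> N) = {}"
  proof -
    have "length (children (h5 p)) \<noteq> 3" if "p \<in> V \<times> V \<times> N" for p
      using that by (cases "snd (snd p)") (auto simp: h5_def N_def V_def split: prod.splits)
    moreover have "length (children (h3 p)) = 3" for p by (simp add: h3_def split: prod.splits)
    ultimately have "h3 p \<noteq> h5 r" if "r \<in> V \<times> V \<times> N" for p r using that by metis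
    then show ?thesis by blast
  qed
  have V_N: "?gf V = fps_X + ?gf N"
  proof -
    have "V = {Leaf} \<union> N" by (auto simp: N_def V_def)
    moreover have "?gf ({Leaf} \<union> N) = ?gf {Leaf} + ?gf N"
      using fN by (intro gen_fun_Un) (auto simp: N_def)
    moreover have "?gf {Leaf} = fps_X"
    proof (rule fps_ext)
      fix n
      have "{a \<in> {Leaf}. leaf_count a = n} = (if n = 1 then {Leaf} else {})" by auto
      then show "fps_nth (?gf {Leaf}) n = fps_nth fps_X n" by (simp add: gen_fun_def)
    qed
    ultimately show ?thesis by simp
  qed
  let ?s2 = "\<lambda>p. leaf_count (fst p) + leaf_count (snd p)"
  let ?w2 = "\<lambda>p. dimension (fst p) + dimension (snd p)"
  let ?s = "\<lambda>p. leaf_count (fst p) + ?s2 (snd p)"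
  let ?w = "\<lambda>p. dimension (fst p) + ?w2 (snd p)"
  have triple: "gen_fun ?s ?w (V \<times> V \<times> A) = ?gf V * (?gf V * ?gf A)"
    if "\<And>n. finite {a \<in> A. leaf_count a = n}" for A
    using gen_fun_times[where s=leaf_count and A=V and s'="?s2" and B="V \<times> A" and w=dimension and w'="?w2"]
      gen_fun_times[where s=leaf_count and A=V and s'=leaf_count and B=A and w=dimension and w'=dimension]
      finite_size_times[where s=leaf_count and A=V and s'=leaf_count and B=A] fV that by simp
  have g3: "?gf (h3 ` (V \<times> V \<times> V)) = qvar * (?gf V * (?gf V * ?gf V))"
  proof -
    have "?gf (h3 ` (V \<times> V \<times> V)) = gen_fun ?s (\<lambda>p. ?w p + 1) (V \<times> V \<times> V)"
      unfolding gen_fun_image[OF inj3] by (rule gen_fun_cong) (auto simp: h3_def)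
    then show ?thesis using gen_fun_add_weight[of ?s ?w 1] triple[OF fV] by simp
  qed
  have g5: "?gf (h5 ` (V \<times> V \<times> N)) = qvar\<^sup>2 * (?gf V * (?gf V * ?gf N))"
  proof -
    \<comment> \<open>Two more children raise the dimension by 2. The truncated subtraction in
      \<open>dimension\<close> is exact here because the old node has at least two children.\<close>
    have "?gf (h5 ` (V \<times> V \<times> N)) = gen_fun ?s (\<lambda>p. ?w p + 2) (V \<times> V \<times> N)"
      unfolding gen_fun_image[OF inj5]
    proof (rule gen_fun_cong)
      fix p assume p: "p \<in> V \<times> V \<times> N"
      then obtain a b ts where "p = (a, b, Node ts)" "2 \<le> length ts"
        by (cases "snd (snd p)") (auto simp: N_def V_def)
      then show "(leaf_count \<circ> h5) p = ?s p" "(dimension \<circ> h5) p = ?w p + 2"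
        by (simp_all add: h5_def)
    qed
    then show ?thesis using gen_fun_add_weight[of ?s ?w 2] triple[OF fN] by simp
  qed
  have "?gf N = ?gf (h3 ` (V \<times> V \<times> V)) + ?gf (h5 ` (V \<times> V \<times> N))"
  proof -
    have "finite {t \<in> h3 ` (V \<times> V \<times> V). leaf_count t = n}"
      "finite {t \<in> h5 ` (V \<times> V \<times> N). leaf_count t = n}" for n
      by (rule finite_subset[OF _ fN[of n]]; use N_eq in blast)+
    then show ?thesis by (subst N_eq, intro gen_fun_Un disj)
  qed
  then have "?gf N * (1 - qvar\<^sup>2 * (?gf V)\<^sup>2) = qvar * ?gf V ^ 3"
    unfolding g3 g5 by (simp add: algebra_simps power2_eq_square power3_eq_cube)
  then show ?thesis using V_N by (simp add: tree_series_def V_def)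
qed

section \<open>Trees and their coverings\<close>

text \<open>Lets the neighbours of a vertex be listed in clockwise order from a chosen one, each
  exactly once.\<close>

lemma cyclic_on_funpow_bij:
  assumes fin: "finite S" and cyc: "cyclic_on f S" and u: "u \<in> S"
  shows "bij_betw (\<lambda>i. (f ^^ i) u) {..<card S} S" and "(f ^^ card S) u = u"
proof -
  have S: "S = orbit f u" using cyc u by (simp add: cyclic_on_alldef)
  then have uu: "u \<in> orbit f u" using u by simp
  have inj: "inj_on (\<lambda>i. (f ^^ i) u) {0..<funpow_dist1 f u u}"
    by (rule inj_on_funpow_dist1[OF uu])
  have im: "S = (\<lambda>i. (f ^^ i) u) ` {0..<funpow_dist1 f u u}"
    using orbit_conv_funpow_dist1[OF uu] S by simp
  then have card: "card S = funpow_dist1 f u u"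
    using card_image[OF inj] by simp
  show "bij_betw (\<lambda>i. (f ^^ i) u) {..<card S} S"
  proof -
    have "bij_betw (\<lambda>i. (f ^^ i) u) {0..<funpow_dist1 f u u} S"
      unfolding bij_betw_def using inj im by blast
    then show ?thesis by (simp only: card atLeast0LessThan)
  qed
  show "(f ^^ card S) u = u" using funpow_dist1_prop[OF uu] by (simp only: card)
qed

text \<open>Loop erasure: if the new first vertex already occurs, the part before that occurrence is
  cut off.\<close>

lemma rtrancl_distinct_path:
  assumes "(p, q) \<in> r\<^sup>*"
  obtains ws where "ws \<noteq> []" "hd ws = p" "last ws = q" "distinct ws" "successively (\<lambda>u v. (u, v) \<in> r) ws"
proof -
  have "\<exists>ws. ws \<noteq> [] \<and> hd ws = p \<and> last ws = q \<and> distinct ws \<and> successively (\<lambda>u v. (u, v) \<in> r) ws"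
    using assms
  proof (induction rule: converse_rtrancl_induct)
    case base
    show ?case by (rule exI[of _ "[q]"]) simp
  next
    case (step p p')
    then obtain ws where ws: "ws \<noteq> []" "hd ws = p'" "last ws = q" "distinct ws"
      "successively (\<lambda>u v. (u, v) \<in> r) ws" by blast
    show ?case
    proof (cases "p \<in> set ws")
      case True
      then obtain us vs where "ws = us @ p # vs" by (meson split_list)
      then show ?thesis using ws by (intro exI[of _ "p # vs"]) (auto simp: successively_append_iff)
    next
      case False
      then show ?thesis using ws step(1)
        by (intro exI[of _ "p # ws"]) (auto simp: successively_Cons)
    qed
  qed
  then show ?thesis using that by blast
qed

text \<open>Walks without immediate backtracking. This local condition is what a locally injective
  map preserves; distinctness of the vertices is not evidently preserved.\<close>

fun reduced_walk :: "embedded_graph \<Rightarrow> nat list \<Rightarrow> bool" where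
  "reduced_walk T (x # y # z # zs) \<longleftrightarrow> (x, y) \<in> adj T \<and> x \<noteq> z \<and> reduced_walk T (y # z # zs)"
| "reduced_walk T [x, y] \<longleftrightarrow> (x, y) \<in> adj T"
| "reduced_walk T ws \<longleftrightarrow> True"

lemma reduced_walk_ConsD: "reduced_walk T (x # xs) \<Longrightarrow> reduced_walk T xs"
  by (cases "(T, x # xs)" rule: reduced_walk.cases) auto

lemma reduced_walk_successively:
  "reduced_walk T ws \<Longrightarrow> successively (\<lambda>u v. (u, v) \<in> adj T) ws"
  by (induction T ws rule: reduced_walk.induct) auto

lemma is_tree_adj:
  assumes "is_tree T" "(u, v) \<in> adj T"
  shows "(v, u) \<in> adj T" "u \<in> verts T" "v \<in> verts T" "u \<noteq> v"
  using assms by (auto simp: is_tree_def is_simple_graph_def dest: symD irreflD)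

lemma reduced_walk_verts:
  assumes "is_tree T"
  shows "reduced_walk T (x # y # ws) \<Longrightarrow> set (x # y # ws) \<subseteq> verts T"
proof (induction ws arbitrary: x y)
  case Nil
  then show ?case using is_tree_adj[OF assms, of x y] by simp
next
  case (Cons z ws)
  then show ?case using is_tree_adj[OF assms, of x y] Cons.IH[of y z] by simp
qed

text \<open>A first return would close a cycle. Returns after one or two steps are excluded by
  irreflexivity and by the absence of backtracking.\<close>

lemma reduced_walk_distinct:
  assumes T: "is_tree T"
  shows "reduced_walk T ws \<Longrightarrow> distinct ws"
proof (induction ws)
  case (Cons x xs)
  then have xs: "distinct xs" using reduced_walk_ConsD by blast
  have "x \<notin> set xs"
  proof
    assume "x \<in> set xs"
    then obtain ys zs where xs_eq: "xs = ys @ x # zs" "x \<notin> set ys" by (meson split_list_first)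
    have succ: "successively (\<lambda>u v. (u, v) \<in> adj T) ((x # ys) @ x # zs)"
      using reduced_walk_successively[OF Cons.prems] by (simp add: xs_eq)
    then have closing: "(last (x # ys), x) \<in> adj T" "successively (\<lambda>u v. (u, v) \<in> adj T) (x # ys)"
      unfolding successively_append_iff by auto
    have "length (x # ys) \<ge> 3"
    proof (rule ccontr)
      assume "\<not> length (x # ys) \<ge> 3"
      then consider "ys = []" | y where "ys = [y]" by (cases ys; cases "tl ys") auto
      then show False
      proof cases
        case 1
        then show False using closing is_tree_adj(4)[OF T] by auto
      next
        case (2 y)
        then show False using Cons.prems by (simp add: xs_eq)
      qed
    qed
    moreover have "distinct (x # ys)" using xs by (simp add: xs_eq)
    ultimately have "is_cycle T (x # ys)" using closing by (simp add: is_cycle_def)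
    then show False using T by (auto simp: is_tree_def)
  qed
  then show ?case using xs by simp
qed simp

text \<open>A covering map onto a tree is injective: it maps paths to reduced walks, which do not close up.\<close>

lemma covering_inj_on:
  assumes T: "is_tree T"
    and S: "\<And>u v. (u, v) \<in> adj S \<Longrightarrow> (v, u) \<in> adj S"
      "\<And>p q. p \<in> verts S \<Longrightarrow> q \<in> verts S \<Longrightarrow> (p, q) \<in> (adj S)\<^sup>*"
    and adj: "\<And>u v. (u, v) \<in> adj S \<Longrightarrow> (f u, f v) \<in> adj T"
    and inj: "\<And>v. inj_on f (nbrs S v)"
  shows "inj_on f (verts S)"
proof (rule inj_onI, rule ccontr)
  fix p q assume pq: "p \<in> verts S" "q \<in> verts S" "f p = f q" "p \<noteq> q"
  obtain ws where ws: "ws \<noteq> []" "hd ws = p" "last ws = q" "distinct ws"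
    "successively (\<lambda>u v. (u, v) \<in> adj S) ws"
    using rtrancl_distinct_path[OF S(2)[OF pq(1,2)]] by blast
  have "reduced_walk T (map f ws)" using ws(4,5)
  proof (induction ws rule: induct_list012)
    case (3 x y zs)
    show ?case
    proof (cases zs)
      case (Cons z zs')
      then have "x \<in> nbrs S y" "z \<in> nbrs S y" "x \<noteq> z" using S(1) 3 by (auto simp: nbrs_def)
      then have "f x \<noteq> f z" using inj[of y] by (auto dest: inj_onD)
      then show ?thesis using 3 adj Cons by auto
    qed (use 3 adj in auto)
  qed auto
  then have "distinct (map f ws)" by (rule reduced_walk_distinct[OF T])
  moreover obtain vs where vs: "ws = p # vs" using ws by (cases ws) auto
  moreover have "vs \<noteq> []" using vs ws pq by auto
  then have "q \<in> set vs" using vs ws by auto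
  ultimately show False using pq(3) by (auto simp: image_iff)
qed

text \<open>The image is closed under adjacency, since \<open>f\<close> maps neighbourhoods onto
  neighbourhoods, so connectedness of \<open>T\<close> gives surjectivity. Injectivity then lets
  edges be pulled back.\<close>

lemma covering_bij_betw:
  assumes T: "is_tree T"
    and S: "\<And>u v. (u, v) \<in> adj S \<Longrightarrow> (v, u) \<in> adj S" "adj S \<subseteq> verts S \<times> verts S"
      "\<And>p q. p \<in> verts S \<Longrightarrow> q \<in> verts S \<Longrightarrow> (p, q) \<in> (adj S)\<^sup>*" "verts S \<noteq> {}"
    and verts: "f ` verts S \<subseteq> verts T"
    and nbrs: "\<And>v. v \<in> verts S \<Longrightarrow> bij_betw f (nbrs S v) (nbrs T (f v))"
  shows "bij_betw f (verts S) (verts T)"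
    and "\<And>u v. u \<in> verts S \<Longrightarrow> v \<in> verts S \<Longrightarrow> (f u, f v) \<in> adj T \<longleftrightarrow> (u, v) \<in> adj S"
proof -
  have adj: "(f u, f v) \<in> adj T" if "(u, v) \<in> adj S" for u v
    using nbrs[of u] that S(2) by (auto simp: bij_betw_def nbrs_def)
  have inj: "inj_on f (nbrs S v)" for v
  proof (cases "v \<in> verts S")
    case True
    then show ?thesis using nbrs by (simp add: bij_betw_def)
  next
    case False
    then have "nbrs S v = {}" using S(2) by (auto simp: nbrs_def)
    then show ?thesis by simp
  qed
  have inj: "inj_on f (verts S)"
    by (rule covering_inj_on[OF T S(1,3) adj inj])
  have "y \<in> f ` verts S" if xy: "(x, y) \<in> (adj T)\<^sup>*" and x: "x \<in> f ` verts S" for x y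
    using xy x
  proof (induction rule: rtrancl_induct)
    case (step y z)
    then obtain v where v: "v \<in> verts S" "y = f v" by auto
    then have "z \<in> f ` nbrs S v" using nbrs[OF v(1)] step(2) by (auto simp: bij_betw_def nbrs_def)
    then show ?case using S(2) by (auto simp: nbrs_def)
  qed
  moreover obtain s where "s \<in> verts S" using S(4) by auto
  ultimately have "verts T \<subseteq> f ` verts S"
    using T verts unfolding is_tree_def by blast
  then show bij: "bij_betw f (verts S) (verts T)" using inj verts by (auto simp: bij_betw_def)
  show "(f u, f v) \<in> adj T \<longleftrightarrow> (u, v) \<in> adj S" if uv: "u \<in> verts S" "v \<in> verts S" for u v
  proof
    assume "(f u, f v) \<in> adj T"
    then have "f v \<in> f ` nbrs S u" using nbrs[OF uv(1)] by (auto simp: bij_betw_def nbrs_def)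
    then obtain v' where "v' \<in> nbrs S u" "f v' = f v" by auto
    moreover from this have "v' = v" using inj uv S(2) by (auto simp: nbrs_def dest: inj_onD)
    ultimately show "(u, v) \<in> adj S" by (simp add: nbrs_def)
  qed (rule adj)
qed

text \<open>
  \<open>unfolds T u v t\<close>: the part of \<open>T\<close> beyond the edge from \<open>u\<close> to \<open>v\<close>, rooted at \<open>v\<close>, is the plane
  tree \<open>t\<close>; the children of \<open>v\<close> are ordered clockwise starting after \<open>u\<close>.
\<close>

inductive unfolds :: "embedded_graph \<Rightarrow> nat \<Rightarrow> nat \<Rightarrow> ptree \<Rightarrow> bool" for T where
  Leaf: "(u, v) \<in> adj T \<Longrightarrow> deg T v = 1 \<Longrightarrow> unfolds T u v Leaf"
| Node: "(u, v) \<in> adj T \<Longrightarrow> ts \<noteq> [] \<Longrightarrow> deg T v = Suc (length ts) \<Longrightarrow>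
    (\<And>i. i < length ts \<Longrightarrow> unfolds T v ((rot T v ^^ Suc i) u) (ts ! i)) \<Longrightarrow> unfolds T u v (Node ts)"

lemma unfolds_adj: "unfolds T u v t \<Longrightarrow> (u, v) \<in> adj T"
  by (auto elim: unfolds.cases)

lemma unfolds_deg: "unfolds T u v t \<Longrightarrow> deg T v = Suc (length (children t))"
  by (auto elim: unfolds.cases)

lemma unfolds_child:
  "unfolds T u v t \<Longrightarrow> i < length (children t) \<Longrightarrow>
    unfolds T v ((rot T v ^^ Suc i) u) (children t ! i)"
  by (auto elim: unfolds.cases)

lemma unfolds_unique:
  assumes "unfolds T u v t" "unfolds T u v t'"
  shows "t = t'"
  using assms
proof (induction arbitrary: t')
  case (Leaf u v)
  from Leaf(3) show ?case using Leaf(2) by cases auto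
next
  case (Node u v ts)
  from Node.prems show ?case
  proof cases
    case (Node ts')
    then show ?thesis using Node.IH \<open>deg T v = Suc (length ts)\<close>
      by (auto intro!: nth_equalityI)
  qed (use Node in auto)
qed

lemma unfolds_og_shape:
  assumes "unfolds T u v t" "is_tree T"
    and "\<And>x. x \<in> verts T \<Longrightarrow> deg T x \<noteq> 1 \<Longrightarrow> even (deg T x) \<and> 4 \<le> deg T x"
  shows "og_shape t"
  using assms(1)
proof induction
  case (Node u v ts)
  then have "even (Suc (length ts)) \<and> 4 \<le> Suc (length ts)"
    using assms(3)[of v] is_tree_adj(3)[OF assms(2)] by auto
  then show ?case using Node.IH by (auto simp: in_set_conv_nth)
qed simp

lemma planar_tree_tree: "planar_tree n T \<Longrightarrow> is_tree T"
  by (simp add: planar_tree_def)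

lemma is_tree_finite_nbrs: "is_tree T \<Longrightarrow> finite (nbrs T v)"
  by (rule finite_subset[of _ "verts T"]) (auto simp: nbrs_def is_tree_def is_simple_graph_def)

lemma planar_tree_rot_bij:
  assumes T: "planar_tree n T" and u: "(u, v) \<in> adj T"
  shows "bij_betw (\<lambda>i. (rot T v ^^ i) u) {..<deg T v} (nbrs T v)"
    and "(rot T v ^^ deg T v) u = u"
proof -
  have v: "v \<in> verts T" and uv: "u \<in> nbrs T v"
    using is_tree_adj[OF planar_tree_tree[OF T] u] by (auto simp: nbrs_def)
  then have "cyclic_on (rot T v) (nbrs T v)"
    using T by (auto simp: planar_tree_def)
  then show "bij_betw (\<lambda>i. (rot T v ^^ i) u) {..<deg T v} (nbrs T v)"
    "(rot T v ^^ deg T v) u = u"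
    using cyclic_on_funpow_bij[OF is_tree_finite_nbrs[OF planar_tree_tree[OF T]] _ uv]
    unfolding deg_def by auto
qed

lemma deg_pos:
  assumes T: "is_tree T" and "(u, v) \<in> adj T"
  shows "0 < deg T v"
  using is_tree_adj(1)[OF assms] is_tree_finite_nbrs[OF T, of v]
  by (auto simp: deg_def nbrs_def card_gt_0_iff)

text \<open>The list \<open>ws\<close> remembers the way back. Each step outwards prolongs a reduced
  walk, whose vertices are distinct, so the number of vertices bounds the recursion.\<close>

lemma unfolds_exists:
  assumes T: "planar_tree n T" and "reduced_walk T (v # u # ws)"
  shows "\<exists>t. unfolds T u v t"
  using assms(2)
proof (induction "card (verts T) - length ws" arbitrary: v u ws rule: less_induct)
  case less
  note tree = planar_tree_tree[OF T]
  have uv: "(u, v) \<in> adj T"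
    using reduced_walk_successively[OF less.prems] is_tree_adj(1)[OF tree] by auto
  obtain m where m: "deg T v = Suc m" using deg_pos[OF tree uv] gr0_conv_Suc by blast
  note bij = planar_tree_rot_bij(1)[OF T uv]
  show ?case
  proof (cases "m = 0")
    case True
    then show ?thesis using unfolds.Leaf uv m by auto
  next
    case False
    have "\<exists>t. unfolds T v ((rot T v ^^ Suc i) u) t" if i: "i < m" for i
    proof (rule less.hyps)
      let ?w = "(rot T v ^^ Suc i) u"
      have "?w \<in> nbrs T v" by (rule bspec[OF bij_betwE[OF bij], of "Suc i"]) (use i m in simp)
      \<comment> \<open>The first \<open>deg T v\<close> iterates of the rotation from
        \<open>u\<close> are distinct, so no child is the vertex from which \<open>v\<close> was
        entered.\<close>
      moreover have "?w \<noteq> (rot T v ^^ 0) u"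
      proof
        assume "?w = (rot T v ^^ 0) u"
        then have "Suc i = 0"
          by (rule inj_onD[OF bij_betw_imp_inj_on[OF bij]]) (use i m in auto)
        then show False by simp
      qed
      ultimately show walk: "reduced_walk T (?w # v # u # ws)"
        using less.prems is_tree_adj(1)[OF tree] by (auto simp: nbrs_def)
      have "set (?w # v # u # ws) \<subseteq> verts T"
        using walk by (rule reduced_walk_verts[OF tree])
      moreover have "finite (verts T)" using tree by (simp add: is_tree_def is_simple_graph_def)
      moreover have "card (set (?w # v # u # ws)) = length (?w # v # u # ws)"
        using reduced_walk_distinct[OF tree walk] by (rule distinct_card)
      ultimately have "length (?w # v # u # ws) \<le> card (verts T)" by (metis card_mono)
      then show "card (verts T) - length (u # ws) < card (verts T) - length ws" by simp
    qed
    then obtain g where g: "\<And>i. i < m \<Longrightarrow> unfolds T v ((rot T v ^^ Suc i) u) (g i)" by metis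
    have "unfolds T u v (Node (map g [0..<m]))"
      using uv m False g by (intro unfolds.Node) (auto simp del: funpow.simps)
    then show ?thesis by blast
  qed
qed

section \<open>Invariants under planar isomorphism\<close>

lemma planar_iso_nbrs_image:
  assumes S: "is_tree S" and T: "is_tree T" and f: "planar_iso n S T f" and v: "v \<in> verts S"
  shows "bij_betw f (nbrs S v) (nbrs T (f v))"
proof -
  have sub: "nbrs S v \<subseteq> verts S" "nbrs T (f v) \<subseteq> verts T"
    using is_tree_adj[OF S] is_tree_adj[OF T] by (auto simp: nbrs_def)
  have b: "inj_on f (verts S)" "f ` verts S = verts T"
    using f by (auto simp: planar_iso_def bij_betw_def)
  have "f ` nbrs S v = nbrs T (f v)"
  proof (intro equalityI subsetI)
    fix y assume y: "y \<in> nbrs T (f v)"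
    then obtain u where "u \<in> verts S" "y = f u" using sub(2) b(2) by blast
    then show "y \<in> f ` nbrs S v" using planar_iso_nbrs[OF f v] y by simp
  next
    fix y assume "y \<in> f ` nbrs S v"
    then obtain u where "u \<in> nbrs S v" "y = f u" by blast
    then show "y \<in> nbrs T (f v)" using planar_iso_nbrs[OF f v, of u] sub(1) by blast
  qed
  then show ?thesis using inj_on_subset[OF b(1) sub(1)] by (simp add: bij_betw_def)
qed

lemma planar_iso_deg:
  assumes "is_tree S" "is_tree T" "planar_iso n S T f" "v \<in> verts S"
  shows "deg T (f v) = deg S v"
  using planar_iso_nbrs_image[OF assms] by (simp add: deg_def bij_betw_same_card)

text \<open>\<open>f\<close> intertwines the rotations, so the \<open>i\<close>-th child goes to the
  \<open>i\<close>-th child. This makes the unfolded shape an isomorphism invariant.\<close>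

lemma planar_iso_unfolds:
  assumes S: "planar_tree n S" and T: "planar_tree n T" and f: "planar_iso n S T f"
    and "unfolds S u v t"
  shows "unfolds T (f u) (f v) t"
  using assms(4)
proof induction
  case (Leaf u v)
  then have uv: "u \<in> verts S" "v \<in> verts S"
    using is_tree_adj[OF planar_tree_tree[OF S]] by auto
  show ?case using Leaf uv f planar_iso_deg[OF planar_tree_tree[OF S] planar_tree_tree[OF T] f]
    by (intro unfolds.Leaf) (auto simp: planar_iso_def)
next
  case (Node u v ts)
  then have uv: "u \<in> verts S" "v \<in> verts S" "u \<in> nbrs S v"
    using is_tree_adj[OF planar_tree_tree[OF S]] by (auto simp: nbrs_def)
  have rot: "(rot S v ^^ i) u \<in> nbrs S v \<and> (rot T (f v) ^^ i) (f u) = f ((rot S v ^^ i) u)" for i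
    using f uv planar_tree_rot_in(1)[OF S uv(2)] by (induction i) (auto simp: planar_iso_def)
  show ?case
  proof (rule unfolds.Node)
    show "(f u, f v) \<in> adj T" using Node uv f by (auto simp: planar_iso_def)
    show "deg T (f v) = Suc (length ts)"
      using Node uv planar_iso_deg[OF planar_tree_tree[OF S] planar_tree_tree[OF T] f] by auto
    show "unfolds T (f v) ((rot T (f v) ^^ Suc i) (f u)) (ts ! i)" if "i < length ts" for i
      using Node.IH[OF that] rot[of "Suc i"] by simp
  qed fact
qed

lemma planar_iso_internal_verts:
  assumes S: "planar_tree n S" and f: "planar_iso n S T f"
  shows "internal_verts n T = f ` internal_verts n S"
proof -
  have "bdry T ` {1..n} = f ` bdry S ` {1..n}" "bdry S ` {1..n} \<subseteq> verts S"
    using f S by (auto simp: planar_iso_def image_iff planar_tree_def)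
  moreover have "inj_on f (verts S)" "f ` verts S = verts T"
    using f by (auto simp: planar_iso_def bij_betw_def)
  ultimately show ?thesis
    unfolding internal_verts_def using inj_on_image_set_diff[of f "verts S" "verts S" "bdry S ` {1..n}"]
    by simp
qed

lemma planar_iso_OG_tree:
  assumes S: "planar_tree (2 * k) S" and T: "planar_tree (2 * k) T" and f: "planar_iso (2 * k) S T f"
  shows "OG_tree k T \<longleftrightarrow> OG_tree k S" and "O_dimension k T = O_dimension k S"
proof -
  note tS = planar_tree_tree[OF S] and tT = planar_tree_tree[OF T]
  have deg: "deg T (f v) = deg S v" if "v \<in> internal_verts (2 * k) S" for v
    using planar_iso_deg[OF tS tT f] that by (simp add: internal_verts_def)
  show "OG_tree k T \<longleftrightarrow> OG_tree k S"
    using S T deg by (auto simp: OG_tree_def planar_iso_internal_verts[OF S f])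
  have "inj_on f (internal_verts (2 * k) S)"
    using f by (auto simp: planar_iso_def bij_betw_def internal_verts_def intro: inj_on_subset)
  then show "O_dimension k T = O_dimension k S"
    using deg by (simp add: O_dimension_def planar_iso_internal_verts[OF S f] sum.reindex)
qed

section \<open>Canonical planar trees\<close>

text \<open>
  Vertices of the canonical embedding of \<open>t\<close> are addressed by reversed paths: \<open>[]\<close> is the boundary
  vertex \<open>1\<close>, \<open>[0]\<close> is the root of \<open>t\<close>, and \<open>i # p\<close> is the \<open>i\<close>-th child of \<open>p\<close>.
\<close>

fun subtree_at :: "ptree \<Rightarrow> nat list \<Rightarrow> ptree" where
  "subtree_at t [] = Node [t]"
| "subtree_at t (i # p) = children (subtree_at t p) ! i"

definition arity :: "ptree \<Rightarrow> nat list \<Rightarrow> nat" where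
  "arity t p = length (children (subtree_at t p))"

text \<open>List access out of range is unspecified, so \<open>subtree_at\<close> is meaningful only
  at these addresses.\<close>

fun valid_addr :: "ptree \<Rightarrow> nat list \<Rightarrow> bool" where
  "valid_addr t [] \<longleftrightarrow> True"
| "valid_addr t (i # p) \<longleftrightarrow> valid_addr t p \<and> i < arity t p"

text \<open>\<open>[]\<close> acts as a node whose only child is \<open>t\<close>. It has no parent,
  so its degree equals its arity instead of exceeding it by one; hence the separate root cases
  below.\<close>

lemma arity_Nil [simp]: "arity t [] = 1"
  by (simp add: arity_def)

text \<open>A preorder listing. It is a list because its order, restricted to the leaves, becomes
  the clockwise order of the boundary.\<close>

function subtrees :: "ptree \<Rightarrow> nat list \<Rightarrow> (nat list \<times> ptree) list" where
  "subtrees t p = (p, t) # concat (map (\<lambda>i. subtrees (children t ! i) (i # p)) [0..<length (children t)])"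
  by pat_completeness auto
termination
proof (relation "measure (size \<circ> fst)")
  fix t p i assume "i \<in> set [0..<length (children t)]"
  then have "children t ! i \<in> set (children t)" by simp
  then show "((children t ! i, i # p), (t, p)) \<in> measure (size \<circ> fst)"
    by (cases t) (auto dest: size_list_estimation'[OF _ order_refl, of _ _ size] simp: less_Suc_eq_le)
qed simp

declare subtrees.simps [simp del]

lemma subtrees_Leaf: "subtrees Leaf p = [(p, Leaf)]"
  by (subst subtrees.simps) simp

lemma subtrees_Node:
  "subtrees (Node ts) p = (p, Node ts) # concat (map (\<lambda>i. subtrees (ts ! i) (i # p)) [0..<length ts])"
  by (subst subtrees.simps) simp

lemma ptree_child_induct [case_names child]:
  assumes "\<And>t. (\<And>i. i < length (children t) \<Longrightarrow> P (children t ! i)) \<Longrightarrow> P t"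
  shows "P t"
proof (induction t)
  case Leaf
  show ?case by (rule assms) simp
next
  case (Node ts)
  show ?case by (rule assms) (use Node in simp)
qed

lemma set_subtrees:
  "set (subtrees t p) = insert (p, t) (\<Union>i<length (children t). set (subtrees (children t ! i) (i # p)))"
  by (subst subtrees.simps) auto

lemma subtrees_valid:
  "valid_addr t0 p \<Longrightarrow> subtree_at t0 p = t \<Longrightarrow> (q, s) \<in> set (subtrees t p) \<Longrightarrow>
    valid_addr t0 q \<and> subtree_at t0 q = s \<and> (\<exists>r. q = r @ p)"
proof (induction t arbitrary: p rule: ptree_child_induct)
  case (child t)
  from child.prems(3) consider "q = p" "s = t"
    | i where "i < length (children t)" "(q, s) \<in> set (subtrees (children t ! i) (i # p))"
    by (subst (asm) set_subtrees) auto
  then show ?case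
  proof cases
    case 1
    then show ?thesis using child.prems by simp
  next
    case (2 i)
    then have "valid_addr t0 q \<and> subtree_at t0 q = s \<and> (\<exists>r. q = r @ i # p)"
      using child by (intro child.IH) (auto simp: arity_def)
    then show ?thesis by (metis append.assoc append_Cons append_Nil)
  qed
qed

lemma subtrees_suffix: "(q, s) \<in> set (subtrees t p) \<Longrightarrow> \<exists>r. q = r @ p"
proof (induction t arbitrary: p rule: ptree_child_induct)
  case (child t)
  then consider "q = p"
    | i where "i < length (children t)" "(q, s) \<in> set (subtrees (children t ! i) (i # p))"
    by (subst (asm) (2) set_subtrees) auto
  then show ?case
  proof cases
    case (2 i)
    then obtain r where "q = r @ i # p" using child.IH by blast
    then show ?thesis by (metis append.assoc append_Cons append_Nil)
  qed auto
qed

lemma subtrees_closed: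
  "(q, s) \<in> set (subtrees t p) \<Longrightarrow> i < length (children s) \<Longrightarrow> (i # q, children s ! i) \<in> set (subtrees t p)"
proof (induction t arbitrary: p rule: ptree_child_induct)
  case (child t)
  from child.prems(1) consider "q = p" "s = t"
    | j where "j < length (children t)" "(q, s) \<in> set (subtrees (children t ! j) (j # p))"
    by (subst (asm) set_subtrees) auto
  then show ?case
  proof cases
    case 1
    have "(i # p, children t ! i) \<in> set (subtrees (children t ! i) (i # p))"
      by (subst set_subtrees) simp
    then show ?thesis using 1 child.prems(2) by (subst set_subtrees) auto
  next
    case (2 j)
    then show ?thesis using child by (subst set_subtrees) blast
  qed
qed

lemma valid_addr_iff_subtrees:
  "p \<noteq> [] \<Longrightarrow> valid_addr t p \<Longrightarrow> (p, subtree_at t p) \<in> set (subtrees t [0])"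
proof (induction p)
  case (Cons i p)
  show ?case
  proof (cases "p = []")
    case True
    then show ?thesis using Cons by (subst set_subtrees) simp
  next
    case False
    then show ?thesis using Cons subtrees_closed[of p _ t "[0]" i] by (simp add: arity_def)
  qed
qed simp

lemma set_subtrees_root:
  "set (subtrees t [0]) = (\<lambda>p. (p, subtree_at t p)) ` {p. valid_addr t p \<and> p \<noteq> []}"
proof (intro equalityI subsetI)
  fix x assume x: "x \<in> set (subtrees t [0])"
  then have "valid_addr t (fst x) \<and> subtree_at t (fst x) = snd x \<and> (\<exists>r. fst x = r @ [0])"
    by (intro subtrees_valid) auto
  then show "x \<in> (\<lambda>p. (p, subtree_at t p)) ` {p. valid_addr t p \<and> p \<noteq> []}"
    by (intro image_eqI[of _ _ "fst x"]) auto
qed (auto simp: valid_addr_iff_subtrees)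

lemma finite_valid_addr: "finite {p. valid_addr t p}"
proof -
  have "{p. valid_addr t p} \<subseteq> insert [] (fst ` set (subtrees t [0]))"
    unfolding set_subtrees_root image_image by auto
  then show ?thesis by (rule finite_subset) simp
qed

text \<open>Addresses are reversed paths, so those below the children \<open>i\<close> and
  \<open>j\<close> of \<open>p\<close> end in \<open>i # p\<close> and \<open>j # p\<close> and
  cannot coincide.\<close>

lemma distinct_subtrees: "distinct (map fst (subtrees t p))"
proof (induction t arbitrary: p rule: ptree_child_induct)
  case (child t)
  let ?n = "length (children t)"
  let ?f = "\<lambda>i. map fst (subtrees (children t ! i) (i # p))"
  have suff: "\<exists>r. q = r @ i # p" if "q \<in> set (?f i)" for q i
    using that subtrees_suffix by fastforce
  have disj: "set (?f i) \<inter> set (?f j) = {}" if "i \<noteq> j" for i j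
  proof (rule ccontr)
    assume "set (?f i) \<inter> set (?f j) \<noteq> {}"
    then obtain q where "q \<in> set (?f i)" "q \<in> set (?f j)" by blast
    then obtain r r' where "r @ i # p = r' @ j # p" using suff by metis
    then have "rev (r @ i # p) = rev (r' @ j # p)" by (simp only:)
    then show False using that by simp
  qed
  have "p \<notin> set (?f i)" for i using suff by fastforce
  moreover have "distinct (concat (map ?f [0..<n]))" if "n \<le> ?n" for n
    using that
  proof (induction n)
    case (Suc n)
    have "set (concat (map ?f [0..<n])) \<inter> set (?f n) = {}"
    proof (rule equals0I)
      fix q assume q: "q \<in> set (concat (map ?f [0..<n])) \<inter> set (?f n)"
      then have "q \<in> (\<Union>j<n. set (?f j))" by (simp only: set_concat set_map Int_iff) auto
      then obtain j where "j < n" "q \<in> set (?f j)" by blast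
      then show False using disj[of j n] q by blast
    qed
    moreover have "distinct (?f n)" using child[of n] Suc.prems by simp
    ultimately show ?case
      using Suc by (simp only: upt_Suc_append[OF le0] map_append concat_append distinct_append list.map concat.simps append_Nil2)
  qed simp
  moreover have "map fst (subtrees t p) = p # concat (map ?f [0..<?n])"
    by (subst subtrees.simps) (simp add: map_concat comp_def)
  moreover have "set (concat (map ?f [0..<?n])) = (\<Union>i<?n. set (?f i))"
    by (simp only: set_concat set_map) auto
  ultimately show ?case by (simp only: distinct.simps UN_iff) blast
qed

definition leaf_addrs :: "ptree \<Rightarrow> nat list \<Rightarrow> nat list list" where
  "leaf_addrs t p = map fst (filter (\<lambda>x. snd x = Leaf) (subtrees t p))"

lemma leaf_addrs_Leaf [simp]: "leaf_addrs Leaf p = [p]"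
  by (simp add: leaf_addrs_def subtrees_Leaf)

lemma leaf_addrs_Node [simp]:
  "leaf_addrs (Node ts) p = concat (map (\<lambda>i. leaf_addrs (ts ! i) (i # p)) [0..<length ts])"
  by (simp add: leaf_addrs_def subtrees_Node filter_concat map_concat comp_def)

lemma length_leaf_addrs: "length (leaf_addrs t p) = leaf_count t"
proof (induction t arbitrary: p)
  case (Node ts)
  have "length (leaf_addrs (Node ts) p) = sum_list (map (\<lambda>i. leaf_count (ts ! i)) [0..<length ts])"
    unfolding leaf_addrs_Node length_concat map_map comp_def
    by (intro arg_cong[of _ _ sum_list] map_cong refl Node.IH) simp
  also have "map (\<lambda>i. leaf_count (ts ! i)) [0..<length ts] = map leaf_count ts"
    by (rule nth_equalityI) auto
  finally show ?case by simp
qed simp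

lemma sum_list_concat: "sum_list (concat xss) = sum_list (map sum_list xss)"
  by (induction xss) simp_all

text \<open>Leaves may be included in the sum, since \<open>0 - 2\<close> is 0 on natural
  numbers.\<close>

lemma sum_list_arity_subtrees:
  "sum_list (map (\<lambda>x. length (children (snd x)) - 2) (subtrees t p)) = dimension t"
proof (induction t arbitrary: p)
  case (Node ts)
  have "sum_list (map (\<lambda>x. length (children (snd x)) - 2) (subtrees (Node ts) p))
     = (length ts - 2) + sum_list (map (\<lambda>i. sum_list (map (\<lambda>x. length (children (snd x)) - 2)
         (subtrees (ts ! i) (i # p)))) [0..<length ts])"
    by (simp add: subtrees_Node map_concat sum_list_concat comp_def)
  also have "\<dots> = (length ts - 2) + sum_list (map (\<lambda>i. dimension (ts ! i)) [0..<length ts])"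
    by (intro arg_cong[of _ _ "(+) (length ts - 2)"] arg_cong[of _ _ sum_list] map_cong refl Node.IH) simp
  also have "map (\<lambda>i. dimension (ts ! i)) [0..<length ts] = map dimension ts"
    by (rule nth_equalityI) auto
  finally show ?case by simp
qed (simp add: subtrees_Leaf)

lemma set_leaf_addrs: "set (leaf_addrs t [0]) = {p. valid_addr t p \<and> p \<noteq> [] \<and> subtree_at t p = Leaf}"
  unfolding leaf_addrs_def set_map set_filter set_subtrees_root by (auto simp: image_iff)

lemma distinct_leaf_addrs: "distinct (leaf_addrs t p)"
  unfolding leaf_addrs_def by (rule distinct_map_filter[OF distinct_subtrees])

lemma og_shape_subtree_at: "og_shape t \<Longrightarrow> valid_addr t p \<Longrightarrow> p \<noteq> [] \<Longrightarrow> og_shape (subtree_at t p)"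
proof (induction p)
  case (Cons i p)
  show ?case
  proof (cases "p = []")
    case False
    then have "og_shape (subtree_at t p)" "i < length (children (subtree_at t p))"
      using Cons by (auto simp: arity_def)
    then show ?thesis by (cases "subtree_at t p") auto
  qed (use Cons in simp)
qed simp

lemma arity_og_shape:
  assumes "og_shape t" "valid_addr t p" "p \<noteq> []"
  shows "arity t p = 0 \<longleftrightarrow> subtree_at t p = Leaf"
    and "arity t p \<noteq> 0 \<Longrightarrow> odd (arity t p) \<and> 3 \<le> arity t p"
proof -
  have "(arity t p = 0 \<longleftrightarrow> subtree_at t p = Leaf) \<and> (arity t p \<noteq> 0 \<longrightarrow> odd (arity t p) \<and> 3 \<le> arity t p)"
  proof (cases "subtree_at t p")
    case (Node ts)
    then have "odd (length ts)" "3 \<le> length ts" using og_shape_subtree_at[OF assms] by simp_all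
    then show ?thesis by (auto simp: arity_def Node)
  qed (simp add: arity_def)
  then show "arity t p = 0 \<longleftrightarrow> subtree_at t p = Leaf"
    "arity t p \<noteq> 0 \<Longrightarrow> odd (arity t p) \<and> 3 \<le> arity t p" by blast+
qed

subsection \<open>The canonical embedding\<close>

text \<open>The vertices of an \<open>embedded_graph\<close> are natural numbers, so addresses are
  encoded.\<close>

definition code :: "nat list \<Rightarrow> nat" where "code = to_nat"
definition decode :: "nat \<Rightarrow> nat list" where "decode = from_nat"

lemma decode_code [simp]: "decode (code p) = p"
  by (simp add: code_def decode_def)

lemma code_eq_iff [simp]: "code p = code q \<longleftrightarrow> p = q"
  by (simp add: code_def)

text \<open>Clockwise order around \<open>p\<close>: the parent \<open>tl p\<close>, then the
  children from the first to the last, then the parent again.\<close>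

definition next_addr :: "ptree \<Rightarrow> nat list \<Rightarrow> nat list \<Rightarrow> nat list" where
  "next_addr t p u =
     (if p = [] then [0]
      else let j = (if u = tl p then 0 else Suc (hd u)) in if j < arity t p then j # p else tl p)"

definition canon :: "ptree \<Rightarrow> embedded_graph" where
  "canon t = \<lparr>verts = code ` {p. valid_addr t p},
     adj = {(code p, code (i # p)) | i p. valid_addr t (i # p)}
         \<union> {(code (i # p), code p) | i p. valid_addr t (i # p)},
     rot = (\<lambda>v u. code (next_addr t (decode v) (decode u))),
     bdry = (\<lambda>i. code (([] # leaf_addrs t [0]) ! (i - 1)))\<rparr>"

lemma canon_simps [simp]:
  "verts (canon t) = code ` {p. valid_addr t p}"
  "rot (canon t) (code p) (code q) = code (next_addr t p q)"
  by (simp_all add: canon_def)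

lemma canon_adj_iff:
  "(code p, code q) \<in> adj (canon t) \<longleftrightarrow>
    (\<exists>i. q = i # p \<and> valid_addr t q) \<or> (\<exists>i. p = i # q \<and> valid_addr t p)"
  by (auto simp: canon_def)

lemma canon_adj_cases:
  assumes "(u, v) \<in> adj (canon t)"
  obtains p i where "u = code p" "v = code (i # p)" "valid_addr t (i # p)"
  | p i where "u = code (i # p)" "v = code p" "valid_addr t (i # p)"
  using assms by (auto simp: canon_def)

text \<open>The neighbour reached from the parent after \<open>j\<close> rotations: position 0 is
  the parent, position \<open>Suc i\<close> the child \<open>i\<close>.\<close>

definition around :: "nat list \<Rightarrow> nat \<Rightarrow> nat list" where
  "around p j = (case j of 0 \<Rightarrow> tl p | Suc i \<Rightarrow> i # p)"

lemma around_simps [simp]: "around p 0 = tl p" "around p (Suc i) = i # p"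
  by (simp_all add: around_def)

lemma Cons_neq_tl [simp]: "i # p \<noteq> tl p" "tl p \<noteq> i # p"
  by (cases p; auto dest: arg_cong[of _ _ length])+

lemma inj_around: "inj_on (around p) A"
  by (auto simp: inj_on_def around_def split: nat.splits)

lemma next_addr_around:
  "p \<noteq> [] \<Longrightarrow> next_addr t p (around p j) = (if j < arity t p then around p (Suc j) else tl p)"
  by (cases j) (auto simp: next_addr_def)

lemma canon_nbrs:
  assumes "valid_addr t p" "p \<noteq> []"
  shows "nbrs (canon t) (code p) = code ` around p ` {..arity t p}"
proof -
  have "nbrs (canon t) (code p) = insert (code (tl p)) {code (i # p) | i. i < arity t p}"
    using assms by (cases p) (auto simp: nbrs_def canon_def)
  also have "\<dots> = code ` around p ` {..arity t p}"
  proof -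
    have "{..arity t p} = insert 0 (Suc ` {..<arity t p})"
      using lessThan_Suc_eq_insert_0[of "arity t p"] by (simp add: lessThan_Suc_atMost)
    then show ?thesis by (auto simp: image_image)
  qed
  finally show ?thesis .
qed

lemma canon_nbrs_root: "nbrs (canon t) (code []) = {code [0]}"
  by (auto simp: nbrs_def canon_def)

lemma canon_deg:
  assumes "valid_addr t p" "p \<noteq> []"
  shows "deg (canon t) (code p) = Suc (arity t p)"
proof -
  have "inj_on code X" for X by (simp add: inj_on_def)
  then show ?thesis
    unfolding deg_def canon_nbrs[OF assms] by (simp add: card_image inj_around)
qed

lemma canon_deg_root: "deg (canon t) (code []) = 1"
  by (simp add: deg_def canon_nbrs_root)

lemma canon_rot_funpow:
  assumes "p \<noteq> []" "j \<le> arity t p"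
  shows "(rot (canon t) (code p) ^^ j) (code (tl p)) = code (around p j)"
  using assms(2)
proof (induction j)
  case (Suc j)
  then show ?case using assms(1) by (simp add: next_addr_around)
qed simp

lemma canon_cyclic:
  assumes p: "valid_addr t p"
  shows "cyclic_on (rot (canon t) (code p)) (nbrs (canon t) (code p))"
proof (cases "p = []")
  case True
  have "orbit (rot (canon t) (code [])) (code [0]) = {code [0]}"
    by (simp add: orbit_eq_singleton_iff next_addr_def)
  then show ?thesis by (simp add: True canon_nbrs_root cyclic_on_def)
next
  case False
  let ?f = "rot (canon t) (code p)" and ?x = "code (tl p)"
  note nb = canon_nbrs[OF p False]
  have pow: "(?f ^^ j) ?x = code (around p j)" if "j \<le> arity t p" for j
    using canon_rot_funpow[OF False that] .
  have full: "(?f ^^ Suc (arity t p)) ?x = ?x"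
    using pow[of "arity t p"] False by (simp add: next_addr_around)
  have mem: "code (around p j) \<in> nbrs (canon t) (code p)" if "j \<le> arity t p" for j
    unfolding nb using that by (intro imageI) simp
  have "nbrs (canon t) (code p) = orbit ?f ?x"
  proof (intro equalityI subsetI)
    fix y assume "y \<in> nbrs (canon t) (code p)"
    then obtain j where j: "j \<le> arity t p" "y = (?f ^^ j) ?x" using nb pow by auto
    \<comment> \<open>Orbits consist of positive iterates only, so the parent itself is reached by a
      full turn.\<close>
    have "\<exists>m>0. y = (?f ^^ m) ?x"
    proof (cases "j = 0")
      case True
      then show ?thesis using full j by (intro exI[of _ "Suc (arity t p)"]) simp
    qed (use j in blast)
    then show "y \<in> orbit ?f ?x" unfolding orbit_altdef by blast
  next
    fix y assume "y \<in> orbit ?f ?x"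
    then show "y \<in> nbrs (canon t) (code p)"
    proof induction
      case base
      have "?f ?x = code (if 0 < arity t p then around p (Suc 0) else around p 0)"
        using next_addr_around[OF False, of t 0] by simp
      then show ?case using mem[of 0] mem[of "Suc 0"] by (auto split: if_splits)
    next
      case (step y)
      then obtain j where j: "j \<le> arity t p" "y = code (around p j)" using nb by auto
      then have "?f y = code (if j < arity t p then around p (Suc j) else around p 0)"
        using next_addr_around[OF False, of t j] by simp
      then show ?case using mem[of 0] mem[of "Suc j"] by (auto split: if_splits)
    qed
  qed
  moreover have "?x \<in> nbrs (canon t) (code p)" using mem[of 0] by simp
  ultimately show ?thesis unfolding cyclic_on_def by blast
qed

lemma canon_unfolds:
  assumes "og_shape t" "valid_addr t p" "p \<noteq> []"
  shows "unfolds (canon t) (code (tl p)) (code p) (subtree_at t p)"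
  using assms(2,3)
proof (induction "subtree_at t p" arbitrary: p)
  case Leaf
  then have "arity t p = 0" by (simp add: arity_def flip: Leaf(1))
  then show ?case using Leaf canon_deg[of t p]
    by (cases p) (auto simp flip: Leaf(1) simp: canon_adj_iff intro!: unfolds.Leaf)
next
  case (Node ts)
  have ar: "arity t p = length ts" by (simp add: arity_def flip: Node(2))
  have "og_shape (Node ts)" using og_shape_subtree_at[OF assms(1) Node(3,4)] Node(2) by simp
  then have "ts \<noteq> []" by auto
  show ?case unfolding Node(2)[symmetric]
  proof (rule unfolds.Node)
    show "(code (tl p), code p) \<in> adj (canon t)"
      using Node(3,4) by (cases p) (auto simp: canon_adj_iff)
    show "deg (canon t) (code p) = Suc (length ts)" using canon_deg[OF Node(3,4)] ar by simp
    show "unfolds (canon t) (code p) ((rot (canon t) (code p) ^^ Suc i) (code (tl p))) (ts ! i)"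
      if i: "i < length ts" for i
    proof -
      have "valid_addr t (i # p)" "subtree_at t (i # p) = ts ! i"
        using Node(3) i ar by (simp_all flip: Node(2))
      then have "unfolds (canon t) (code (tl (i # p))) (code (i # p)) (ts ! i)"
        using Node(1)[of "i # p"] i by simp
      then show ?thesis using canon_rot_funpow[OF Node(4), of "Suc i" t] i ar by simp
    qed
  qed fact
qed

lemma canon_connected:
  assumes "valid_addr t p"
  shows "(code p, code []) \<in> (adj (canon t))\<^sup>* \<and> (code [], code p) \<in> (adj (canon t))\<^sup>*"
  using assms
proof (induction p)
  case (Cons i p)
  have "(code (i # p), code p) \<in> adj (canon t)" "(code p, code (i # p)) \<in> adj (canon t)"
    using Cons.prems by (auto simp: canon_adj_iff)
  then show ?case
    using Cons converse_rtrancl_into_rtrancl[of "code (i # p)" "code p"]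
      rtrancl_into_rtrancl[of "code []" "code p"] by simp
qed simp

text \<open>The neighbours of a deepest vertex of a cycle are both its parent.\<close>

lemma canon_acyclic: "\<not> is_cycle (canon t) c"
proof
  assume c: "is_cycle (canon t) c"
  define n where "n = length c"
  have n: "3 \<le> n" and dist: "distinct c" using c by (simp_all add: is_cycle_def n_def)
  then have "c \<noteq> []" by (auto simp: n_def)
  have step: "(c ! i, c ! (Suc i mod n)) \<in> adj (canon t)" if "i < n" for i
  proof (cases "Suc i = n")
    case True
    then have "i = length c - 1" by (simp add: n_def)
    then have "c ! i = last c" using \<open>c \<noteq> []\<close> by (simp add: last_conv_nth)
    moreover have "c ! (Suc i mod n) = hd c" using True \<open>c \<noteq> []\<close> by (simp add: hd_conv_nth)
    ultimately show ?thesis using c by (simp add: is_cycle_def)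
  next
    case False
    then show ?thesis using c that by (auto simp: is_cycle_def n_def successively_conv_nth)
  qed
  let ?d = "\<lambda>v. length (decode v)"
  \<comment> \<open>Each edge joins a vertex to its parent, so a neighbour that is not deeper is the
    parent.\<close>
  have parent: "y = code (tl (decode x))" if "(x, y) \<in> adj (canon t) \<or> (y, x) \<in> adj (canon t)" "?d y \<le> ?d x" for x y
    using that by (auto elim!: canon_adj_cases)
  obtain i where i: "i < n" "\<And>j. j < n \<Longrightarrow> ?d (c ! j) \<le> ?d (c ! i)"
  proof -
    have "finite (?d ` set c)" "?d ` set c \<noteq> {}" using \<open>c \<noteq> []\<close> by auto
    then have "Max (?d ` set c) \<in> ?d ` set c" by (rule Max_in)
    then obtain i where "i < n" "?d (c ! i) = Max (?d ` set c)" by (auto simp: in_set_conv_nth n_def)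
    then show ?thesis using that[of i] by (simp add: n_def)
  qed
  define k where "k = (if i = 0 then n - 1 else i - 1)"
  have k: "k < n" "Suc k mod n = i" using i(1) n by (auto simp: k_def)
  have j: "Suc i mod n < n" using n by simp
  have "c ! (Suc i mod n) = code (tl (decode (c ! i)))" using parent step[OF i(1)] i(2)[OF j] by blast
  moreover have "c ! k = code (tl (decode (c ! i)))" using parent step[OF k(1)] i(2)[OF k(1)] k(2) by metis
  ultimately have "Suc i mod n = k"
    using dist j k(1) nth_eq_iff_index_eq by (metis n_def)
  then show False using i(1) n by (auto simp: k_def mod_Suc split: if_splits)
qed

lemma is_tree_canon: "is_tree (canon t)"
proof -
  have "is_simple_graph (canon t)"
    unfolding is_simple_graph_def
  proof (intro conjI)
    show "finite (verts (canon t))" by (simp add: finite_valid_addr)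
    show "adj (canon t) \<subseteq> verts (canon t) \<times> verts (canon t)" by (auto elim!: canon_adj_cases)
    show "sym (adj (canon t))" by (auto simp: canon_def sym_def)
    show "irrefl (adj (canon t))" by (auto simp: canon_def irrefl_def)
  qed
  moreover have "verts (canon t) \<noteq> {}" by (auto intro: exI[of _ "[]"])
  moreover have "(u, v) \<in> (adj (canon t))\<^sup>*" if "u \<in> verts (canon t)" "v \<in> verts (canon t)" for u v
    using that canon_connected by (auto intro: rtrancl_trans)
  ultimately show ?thesis using canon_acyclic by (auto simp: is_tree_def)
qed

text \<open>
  \<open>tour T B e xs e'\<close>: the contour walk leads from \<open>e\<close> to \<open>e'\<close>, and \<open>xs\<close> lists the heads in \<open>B\<close> of
  the edges traversed, excluding that of \<open>e'\<close>.
\<close>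

inductive tour :: "embedded_graph \<Rightarrow> nat set \<Rightarrow> nat \<times> nat \<Rightarrow> nat list \<Rightarrow> nat \<times> nat \<Rightarrow> bool"
  for T B where
  stop: "tour T B e [] e"
| hit: "snd e \<in> B \<Longrightarrow> tour T B (contour_step T e) xs e' \<Longrightarrow> tour T B e (snd e # xs) e'"
| pass: "snd e \<notin> B \<Longrightarrow> tour T B (contour_step T e) xs e' \<Longrightarrow> tour T B e xs e'"

lemma tour_trans: "tour T B e xs e' \<Longrightarrow> tour T B e' ys e'' \<Longrightarrow> tour T B e (xs @ ys) e''"
  by (induction rule: tour.induct) (auto intro: tour.intros)

text \<open>The induction carries the last boundary vertex \<open>a\<close>, its outgoing edge to
  \<open>w\<close> and the number \<open>m\<close> of steps since then, during which
  \<open>B\<close> was not met.\<close>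

lemma tour_next_clockwise:
  assumes closed: "\<And>u v. (u, v) \<in> adj T \<Longrightarrow> (v, rot T v u) \<in> adj T"
    and "tour T B e xs e'" "e \<in> adj T" "w \<in> nbrs T a" "e = (contour_step T ^^ m) (a, w)"
    "\<And>j. j < m \<Longrightarrow> snd ((contour_step T ^^ j) (a, w)) \<notin> B"
  shows "successively (next_clockwise T B) (a # xs)"
  using assms(2-)
proof (induction arbitrary: a w m rule: tour.induct)
  case (hit e xs e')
  obtain u v where e: "e = (u, v)" by fastforce
  have step: "contour_step T e = (v, rot T v u)" by (simp add: e contour_step_def)
  have dart: "(v, rot T v u) \<in> adj T" using closed hit.prems(1) by (simp add: e)
  have "successively (next_clockwise T B) (v # xs)"
    using dart by (intro hit.IH[of "rot T v u" v 0]) (auto simp: step nbrs_def)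
  moreover have "next_clockwise T B a v"
    unfolding next_clockwise_def using hit.prems e by (metis snd_conv)
  ultimately show ?case by (simp add: e)
next
  case (pass e xs e')
  obtain u v where e: "e = (u, v)" by fastforce
  show ?case
  proof (rule pass.IH)
    show "contour_step T e \<in> adj T" using closed pass.prems(1) by (simp add: e contour_step_def)
    show "contour_step T e = (contour_step T ^^ Suc m) (a, w)" using pass.prems(3) by simp
    show "snd ((contour_step T ^^ j) (a, w)) \<notin> B" if "j < Suc m" for j
      using that pass.hyps(1) pass.prems(3,4) by (auto simp: less_Suc_eq)
  qed fact
qed simp

text \<open>At a vertex with a single neighbour the walk is determined, and so is its first hit in
  \<open>B\<close>.\<close>

lemma next_clockwise_unique:
  assumes "nbrs T a = {w}" "b \<in> B" "b' \<in> B" "next_clockwise T B a b" "next_clockwise T B a b'"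
  shows "b = b'"
proof -
  obtain m where m: "snd ((contour_step T ^^ m) (a, w)) = b"
    "\<And>j. j < m \<Longrightarrow> snd ((contour_step T ^^ j) (a, w)) \<notin> B"
    using assms by (auto simp: next_clockwise_def)
  obtain m' where m': "snd ((contour_step T ^^ m') (a, w)) = b'"
    "\<And>j. j < m' \<Longrightarrow> snd ((contour_step T ^^ j) (a, w)) \<notin> B"
    using assms by (auto simp: next_clockwise_def)
  have "m = m'" using m m' assms(2,3) by (metis linorder_neqE_nat)
  then show ?thesis using m m' by simp
qed

text \<open>A map respecting edges and rotations carries the contour walk of \<open>S\<close> step
  by step to that of \<open>T\<close>, so first hits correspond.\<close>

lemma next_clockwise_hom:
  assumes adj: "\<And>u v. (u, v) \<in> adj S \<Longrightarrow> (f u, f v) \<in> adj T"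
    and rot: "\<And>u v. (u, v) \<in> adj S \<Longrightarrow> rot T (f v) (f u) = f (rot S v u)"
    and closed: "\<And>u v. (u, v) \<in> adj S \<Longrightarrow> (v, rot S v u) \<in> adj S"
    and B: "\<And>u v. (u, v) \<in> adj S \<Longrightarrow> f v \<in> BT \<longleftrightarrow> v \<in> BS"
    and nc: "next_clockwise S BS a b"
  shows "next_clockwise T BT (f a) (f b)"
proof -
  obtain w m where w: "w \<in> nbrs S a" and m: "snd ((contour_step S ^^ m) (a, w)) = b"
    "\<And>j. j < m \<Longrightarrow> snd ((contour_step S ^^ j) (a, w)) \<notin> BS"
    using nc by (auto simp: next_clockwise_def)
  have walk: "(contour_step S ^^ j) (a, w) \<in> adj S \<and>
      (contour_step T ^^ j) (f a, f w) = map_prod f f ((contour_step S ^^ j) (a, w))" for j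
  proof (induction j)
    case 0
    then show ?case using w by (simp add: nbrs_def)
  next
    case (Suc j)
    obtain u v where uv: "(contour_step S ^^ j) (a, w) = (u, v)" by fastforce
    then show ?case using Suc closed rot by (auto simp: contour_step_def)
  qed
  have head: "snd ((contour_step T ^^ j) (f a, f w)) = f (snd ((contour_step S ^^ j) (a, w)))" for j
    using walk[of j] by simp
  have "snd ((contour_step T ^^ j) (f a, f w)) \<in> BT \<longleftrightarrow> snd ((contour_step S ^^ j) (a, w)) \<in> BS" for j
    unfolding head using B walk[of j] by (cases "(contour_step S ^^ j) (a, w)") auto
  then show ?thesis
    unfolding next_clockwise_def using adj w m head by (intro bexI[of _ "f w"] exI[of _ m]) (auto simp: nbrs_def)
qed

lemma planar_tree_dart_closed:
  assumes "planar_tree n T" "(u, v) \<in> adj T"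
  shows "(v, rot T v u) \<in> adj T"
  using planar_tree_rot_in(1)[OF assms(1), of v u] is_tree_adj[OF planar_tree_tree[OF assms(1)] assms(2)]
  by (simp add: nbrs_def)

subsection \<open>The canonical embedding is a planar tree\<close>

definition boundary_addrs :: "ptree \<Rightarrow> nat list list" where
  "boundary_addrs t = [] # leaf_addrs t [0]"

lemma length_boundary_addrs: "length (boundary_addrs t) = Suc (leaf_count t)"
  by (simp add: boundary_addrs_def length_leaf_addrs)

lemma distinct_boundary_addrs: "distinct (boundary_addrs t)"
  by (simp add: boundary_addrs_def distinct_leaf_addrs set_leaf_addrs)

lemma set_boundary_addrs:
  "set (boundary_addrs t) = {p. valid_addr t p \<and> (p = [] \<or> subtree_at t p = Leaf)}"
  by (auto simp: boundary_addrs_def set_leaf_addrs)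

lemma canon_bdry: "bdry (canon t) i = code (boundary_addrs t ! (i - 1))"
  by (simp add: canon_def boundary_addrs_def)

lemma canon_bdry_image: "bdry (canon t) ` {1..Suc (leaf_count t)} = code ` set (boundary_addrs t)"
proof -
  have "bdry (canon t) ` {1..Suc (leaf_count t)} = bdry (canon t) ` Suc ` {..<length (boundary_addrs t)}"
    by (simp only: length_boundary_addrs image_Suc_lessThan)
  also have "\<dots> = code ` (!) (boundary_addrs t) ` {..<length (boundary_addrs t)}"
    by (simp add: image_image canon_bdry)
  also have "(!) (boundary_addrs t) ` {..<length (boundary_addrs t)} = set (boundary_addrs t)"
    by (auto simp: set_conv_nth)
  finally show ?thesis .
qed

lemma canon_deg_eq_1_iff:
  assumes "og_shape t" "valid_addr t p"
  shows "deg (canon t) (code p) = 1 \<longleftrightarrow> p \<in> set (boundary_addrs t)"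
  using assms canon_deg_root[of t] canon_deg[of t p] arity_og_shape(1)[of t p]
  by (cases "p = []") (auto simp: set_boundary_addrs)

text \<open>The walk enters the subtree at \<open>p\<close> from the parent and leaves by the same
  edge reversed. In between it tours the children in order, so the leaves appear in
  preorder.\<close>

lemma canon_tour:
  assumes t: "og_shape t" and B: "\<And>p. code p \<in> B \<longleftrightarrow> p \<in> set (boundary_addrs t)"
    and "valid_addr t p" "p \<noteq> []"
  shows "tour (canon t) B (code (tl p), code p) (map code (leaf_addrs (subtree_at t p) p)) (code p, code (tl p))"
  using assms(3,4)
proof (induction "subtree_at t p" arbitrary: p)
  case Leaf
  then have "arity t p = 0" "code p \<in> B" by (simp_all add: arity_def B set_boundary_addrs)
  moreover from this have "contour_step (canon t) (code (tl p), code p) = (code p, code (tl p))"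
    using Leaf(3) next_addr_around[of p t 0] by (simp add: contour_step_def)
  ultimately show ?case
    using tour.hit[of "(code (tl p), code p)" B "canon t" "[]"] tour.stop[of "canon t" B]
    by (simp flip: Leaf(1))
next
  case (Node ts)
  let ?T = "canon t"
  define m where "m = arity t p"
  have m: "m = length ts" by (simp add: m_def arity_def flip: Node(2))
  have "m \<noteq> 0" using og_shape_subtree_at[OF t Node(3,4)] m by (simp flip: Node(2)) auto
  have p: "code p \<notin> B" using Node(3,4) by (simp add: B set_boundary_addrs flip: Node(2))
  have step: "contour_step ?T (code (around p j), code p)
      = (code p, code (if j < m then around p (Suc j) else tl p))" for j
    using next_addr_around[OF Node(4), of t j] by (simp add: contour_step_def m_def del: around_simps)
  have chain: "tour ?T B (code p, code (around p (Suc 0)))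
      (map code (concat (map (\<lambda>i. leaf_addrs (ts ! i) (i # p)) [0..<j])))
      (code p, code (if j < m then around p (Suc j) else tl p))" if "j \<le> m" for j
    using that
  proof (induction j)
    case 0
    then show ?case using tour.stop \<open>m \<noteq> 0\<close> by simp
  next
    case (Suc j)
    have child: "valid_addr t (j # p)" "subtree_at t (j # p) = ts ! j"
      using Node(3) Suc.prems by (simp_all add: m_def[symmetric] flip: Node(2))
    have "subtree_at t (j # p) \<in> set ts" using child Suc.prems m by simp
    then have "tour ?T B (code (tl (j # p)), code (j # p)) (map code (leaf_addrs (ts ! j) (j # p)))
        (code (j # p), code (tl (j # p)))"
      using Node(1)[of "j # p"] child by simp
    then have "tour ?T B (code p, code (j # p)) (map code (leaf_addrs (ts ! j) (j # p))) (code (j # p), code p)"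
      by simp
    \<comment> \<open>Between two children the walk passes through \<open>p\<close>, which is an
      inner node and records nothing.\<close>
    moreover have "tour ?T B (code (j # p), code p) [] (code p, code (if Suc j < m then around p (Suc (Suc j)) else tl p))"
      using tour.pass[of "(code (j # p), code p)" B ?T "[]"] tour.stop p step[of "Suc j"] by simp
    ultimately have "tour ?T B (code p, code (j # p)) (map code (leaf_addrs (ts ! j) (j # p)) @ [])
        (code p, code (if Suc j < m then around p (Suc (Suc j)) else tl p))"
      by (rule tour_trans)
    moreover have "tour ?T B (code p, code (around p (Suc 0)))
      (map code (concat (map (\<lambda>i. leaf_addrs (ts ! i) (i # p)) [0..<j]))) (code p, code (j # p))"
      using Suc by simp
    ultimately show ?case using tour_trans by fastforce
  qed
  have "tour ?T B (code p, code (around p (Suc 0))) (map code (leaf_addrs (Node ts) p)) (code p, code (tl p))"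
    using chain[of m] by (simp add: m)
  then show ?case
    using tour.pass[of "(code (tl p), code p)" B ?T] p step[of 0] \<open>m \<noteq> 0\<close> by (simp flip: Node(2))
qed

lemma planar_tree_canon:
  assumes t: "og_shape t"
  shows "planar_tree (Suc (leaf_count t)) (canon t)"
proof -
  define n where "n = Suc (leaf_count t)"
  define B where "B = bdry (canon t) ` {1..n}"
  let ?L = "boundary_addrs t"
  have len: "length ?L = n" by (simp add: length_boundary_addrs n_def)
  have B_eq: "B = code ` set ?L" unfolding B_def n_def by (rule canon_bdry_image)
  have B_iff: "code p \<in> B \<longleftrightarrow> p \<in> set ?L" for p by (auto simp: B_eq)
  have valid: "valid_addr t (?L ! i)" if "i < n" for i
    using that nth_mem[of i ?L] by (simp add: len set_boundary_addrs)
  have closed: "(v, rot (canon t) v u) \<in> adj (canon t)" if "(u, v) \<in> adj (canon t)" for u v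
  proof -
    have uv: "(v, u) \<in> adj (canon t)" "v \<in> verts (canon t)" using is_tree_adj[OF is_tree_canon that] by auto
    then obtain p where "v = code p" "valid_addr t p" by auto
    then have "rot (canon t) v u \<in> nbrs (canon t) v"
      using canon_cyclic[of t p] uv cyclic_on_inI by (fastforce simp: nbrs_def)
    then show ?thesis by (simp add: nbrs_def)
  qed
  have "tour (canon t) B (code [], code [0]) (map code (leaf_addrs t [0])) (code [0], code [])"
    using canon_tour[OF t B_iff, of "[0]"] by simp
  \<comment> \<open>After the last leaf the walk comes back to \<open>[]\<close>; this closes the
    circle from label \<open>n\<close> to label \<open>1\<close>.\<close>
  moreover have "tour (canon t) B (code [0], code []) [code []] (code [], code [0])"
    using tour.hit[of "(code [0], code [])" B "canon t" "[]"] tour.stop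
    by (simp add: B_iff set_boundary_addrs contour_step_def next_addr_def)
  ultimately have "tour (canon t) B (code [], code [0]) (map code (leaf_addrs t [0]) @ [code []]) (code [], code [0])"
    by (rule tour_trans)
  then have succ: "successively (next_clockwise (canon t) B) (code [] # (map code (leaf_addrs t [0]) @ [code []]))"
    by (rule tour_next_clockwise[where m=0 and w="code [0]", rotated])
      (auto simp: canon_nbrs_root canon_adj_iff closed)
  have "next_clockwise (canon t) B (bdry (canon t) i) (bdry (canon t) (i mod n + 1))" if i: "i \<in> {1..n}" for i
  proof -
    let ?M = "map code ?L @ [code []]"
    have "successively (next_clockwise (canon t) B) ?M" using succ by (simp add: boundary_addrs_def)
    then have "next_clockwise (canon t) B (?M ! (i - 1)) (?M ! i)"
      using i len unfolding successively_conv_nth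
      by (metis One_nat_def Suc_diff_le Suc_le_mono add.commute atLeastAtMost_iff diff_Suc_1 length_append_singleton
          length_map less_Suc_eq_le plus_1_eq_Suc)
    moreover have "?M ! (i - 1) = bdry (canon t) i"
      using i len by (auto simp: nth_append canon_bdry)
    moreover have "?M ! i = bdry (canon t) (i mod n + 1)"
    proof (cases "i = n")
      case True
      then show ?thesis using len by (simp add: nth_append canon_bdry) (simp add: boundary_addrs_def)
    qed (use i len in \<open>auto simp: nth_append canon_bdry\<close>)
    ultimately show ?thesis by simp
  qed
  moreover have "inj_on (bdry (canon t)) {1..n}"
  proof (rule inj_onI)
    fix i j assume ij: "i \<in> {1..n}" "j \<in> {1..n}" "bdry (canon t) i = bdry (canon t) j"
    then have "?L ! (i - 1) = ?L ! (j - 1)" by (simp add: canon_bdry)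
    moreover have "i - 1 < length ?L" "j - 1 < length ?L" using ij len by auto
    ultimately have "i - 1 = j - 1"
      by (simp only: nth_eq_iff_index_eq[OF distinct_boundary_addrs])
    then show "i = j" using ij by auto
  qed
  moreover have bdry: "bdry (canon t) i \<in> verts (canon t)" "deg (canon t) (bdry (canon t) i) = 1" if i: "i \<in> {1..n}" for i
  proof -
    have "i - 1 < n" using i by auto
    then show "bdry (canon t) i \<in> verts (canon t)" "deg (canon t) (bdry (canon t) i) = 1"
      using valid canon_deg_eq_1_iff[OF t valid] len unfolding canon_bdry by auto
  qed
  moreover have "cyclic_on (rot (canon t) v) (nbrs (canon t) v)" if "v \<in> verts (canon t)" for v
    using that canon_cyclic by auto
  moreover have "B \<subseteq> verts (canon t)" unfolding B_def by (intro image_subsetI bdry(1))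
  ultimately show ?thesis
    using is_tree_canon[of t] unfolding planar_tree_def n_def[symmetric] B_def[symmetric] by blast
qed


subsection \<open>Every planar tree is isomorphic to a canonical one\<close>

text \<open>The vertex of \<open>T\<close> at a given address, where \<open>b\<close> is the boundary vertex \<open>1\<close> and \<open>w\<close> its neighbour.\<close>

fun place :: "embedded_graph \<Rightarrow> nat \<Rightarrow> nat \<Rightarrow> nat list \<Rightarrow> nat" where
  "place T b w [] = b"
| "place T b w [i] = w"
| "place T b w (i # j # p) = (rot T (place T b w (j # p)) ^^ Suc i) (place T b w p)"

lemma place_Cons:
  "p \<noteq> [] \<Longrightarrow> place T b w (i # p) = (rot T (place T b w p) ^^ Suc i) (place T b w (tl p))"
  by (cases p) simp_all

lemma place_unfolds:
  assumes "unfolds T b w t" "valid_addr t p" "p \<noteq> []"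
  shows "unfolds T (place T b w (tl p)) (place T b w p) (subtree_at t p)"
  using assms(2,3)
proof (induction p)
  case (Cons i p)
  show ?case
  proof (cases "p = []")
    case True
    then show ?thesis using Cons assms(1) by simp
  next
    case False
    then show ?thesis
      using Cons unfolds_child[of T "place T b w (tl p)" "place T b w p" "subtree_at t p" i]
      by (simp add: place_Cons arity_def del: funpow.simps)
  qed
qed simp

text \<open>\<open>place\<close> is a covering map, hence a bijection preserving adjacency and
  rotation. Counting the vertices of degree 1 gives \<open>n\<close>, and the labels are matched one
  after the other along the contour.\<close>

lemma planar_iso_canon:
  assumes T: "planar_tree n T" and n: "n \<ge> 1" and b: "b = bdry T 1" and w: "nbrs T b = {w}"
    and t: "unfolds T b w t" "og_shape t"
    and leaves: "bdry T ` {1..n} = {v \<in> verts T. deg T v = 1}"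
  shows "n = Suc (leaf_count t)" and "planar_iso n (canon t) T (\<lambda>v. place T b w (decode v))"
proof -
  let ?S = "canon t"
  let ?p = "place T b w"
  define f where "f v = ?p (decode v)" for v
  note tree = planar_tree_tree[OF T] and ctree = is_tree_canon[of t]
  have f_code [simp]: "f (code p) = ?p p" for p by (simp add: f_def)
  have bv: "b \<in> verts T" using T n b by (auto simp: planar_tree_def)
  have unf: "unfolds T (?p (tl p)) (?p p) (subtree_at t p)" if "valid_addr t p" "p \<noteq> []" for p
    using place_unfolds[OF t(1) that] .
  have degp: "deg T (?p p) = Suc (arity t p)" if "valid_addr t p" "p \<noteq> []" for p
    using unfolds_deg[OF unf[OF that]] by (simp add: arity_def)
  have around: "?p (around p j) = (rot T (?p p) ^^ j) (?p (tl p))" if "p \<noteq> []" for p j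
    using that by (cases j) (simp_all add: place_Cons del: funpow.simps)
  have verts: "f ` verts ?S \<subseteq> verts T"
  proof -
    have "?p p \<in> verts T" if "valid_addr t p" for p
      using bv is_tree_adj(3)[OF tree unfolds_adj[OF unf[OF that]]] by (cases "p = []") auto
    then show ?thesis by auto
  qed
  have nbrs: "bij_betw f (nbrs ?S v) (nbrs T (f v))" if v: "v \<in> verts ?S" for v
  proof -
    obtain p where p: "v = code p" "valid_addr t p" using v by auto
    show ?thesis
    proof (cases "p = []")
      case True
      then show ?thesis using p w by (simp add: canon_nbrs_root)
    next
      case False
      let ?g = "\<lambda>j. code (around p j)"
      have "bij_betw ?g {..arity t p} (nbrs ?S v)"
        unfolding p(1) canon_nbrs[OF p(2) False] bij_betw_def
        using inj_around[of p "{..arity t p}"] by (auto simp: inj_on_def image_image)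
      \<comment> \<open>The iterated rotation in \<open>T\<close>, started at the image of the
        parent, lists the neighbours in the same order as \<open>around\<close>.\<close>
      moreover have "bij_betw (f \<circ> ?g) {..arity t p} (nbrs T (f v))"
      proof -
        have "bij_betw (\<lambda>j. (rot T (?p p) ^^ j) (?p (tl p))) {..<deg T (?p p)} (nbrs T (?p p))"
          by (rule planar_tree_rot_bij(1)[OF T unfolds_adj[OF unf[OF p(2) False]]])
        then show ?thesis
          by (simp add: degp[OF p(2) False] lessThan_Suc_atMost p(1) comp_def around[OF False])
      qed
      ultimately show ?thesis by (simp add: bij_betw_comp_iff)
    qed
  qed
  have S_sub: "adj ?S \<subseteq> verts ?S \<times> verts ?S" and S_conn: "\<And>p q. p \<in> verts ?S \<Longrightarrow> q \<in> verts ?S \<Longrightarrow> (p, q) \<in> (adj ?S)\<^sup>*"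
    and S_ne: "verts ?S \<noteq> {}"
    using ctree by (auto simp: is_tree_def is_simple_graph_def simp del: canon_simps)
  note S_sym = is_tree_adj(1)[OF ctree]
  have bij: "bij_betw f (verts ?S) (verts T)"
    by (rule covering_bij_betw(1)[OF tree, of ?S f]) (fact S_sym S_sub S_conn S_ne verts nbrs)+
  have adj: "(f u, f v) \<in> adj T \<longleftrightarrow> (u, v) \<in> adj ?S" if "u \<in> verts ?S" "v \<in> verts ?S" for u v
    by (rule covering_bij_betw(2)[OF tree, of ?S f]) (fact S_sym S_sub S_conn S_ne verts nbrs that)+
  have rot: "rot T (f v) (f u) = f (rot ?S v u)" if "(u, v) \<in> adj ?S" for u v
  proof -
    have uv: "u \<in> nbrs ?S v" "v \<in> verts ?S" using is_tree_adj[OF ctree that] by (auto simp: nbrs_def)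
    then obtain p where p: "v = code p" "valid_addr t p" by auto
    show ?thesis
    proof (cases "p = []")
      case True
      then have "u = code [0]" using uv p by (simp add: canon_nbrs_root)
      moreover have "(b, w) \<in> adj T" using w by (auto simp: nbrs_def)
      then have "(w, b) \<in> adj T" by (rule is_tree_adj(1)[OF tree])
      \<comment> \<open>\<open>w\<close> is the only neighbour of \<open>b\<close>, so the rotation
        at \<open>b\<close> fixes it.\<close>
      then have "rot T b w = w"
        using planar_tree_dart_closed[OF T] w by (auto simp: nbrs_def)
      ultimately show ?thesis using True p by (simp add: next_addr_def)
    next
      case False
      then obtain j where j: "j \<le> arity t p" "u = code (around p j)"
        using uv canon_nbrs[OF p(2) False] p by auto
      \<comment> \<open>Needed when \<open>u\<close> is the last neighbour: the next one is the
        parent again.\<close>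
      have cyc: "(rot T (?p p) ^^ Suc (arity t p)) (?p (tl p)) = ?p (tl p)"
        using planar_tree_rot_bij(2)[OF T unfolds_adj[OF unf[OF p(2) False]]] degp[OF p(2) False] by simp
      have "rot T (f v) (f u) = (rot T (?p p) ^^ Suc j) (?p (tl p))"
        using p j around[OF False] by simp
      also have "\<dots> = ?p (if j < arity t p then around p (Suc j) else tl p)"
        using around[OF False, of "Suc j"] cyc j by (cases "j = arity t p") auto
      also have "\<dots> = f (rot ?S v u)" using p j next_addr_around[OF False, of t j] by simp
      finally show ?thesis .
    qed
  qed
  have deg: "deg T (f v) = deg ?S v" if "v \<in> verts ?S" for v
    using nbrs[OF that] by (simp add: deg_def bij_betw_same_card)
  let ?B = "code ` set (boundary_addrs t)"
  have B_verts: "?B \<subseteq> verts ?S" by (auto simp: set_boundary_addrs)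
  \<comment> \<open>On both sides the boundary vertices are exactly those of degree 1, and
    \<open>f\<close> preserves degrees.\<close>
  have B_iff: "f v \<in> bdry T ` {1..n} \<longleftrightarrow> v \<in> ?B" if v: "v \<in> verts ?S" for v
  proof -
    have "f v \<in> bdry T ` {1..n} \<longleftrightarrow> deg ?S v = 1"
      using deg[OF v] verts v unfolding leaves by auto
    then show ?thesis using v canon_deg_eq_1_iff[OF t(2)] by auto
  qed
  have "bdry T ` {1..n} = f ` ?B"
  proof (intro equalityI subsetI)
    fix y assume y: "y \<in> bdry T ` {1..n}"
    then have "y \<in> verts T" unfolding leaves by simp
    then obtain v where "v \<in> verts ?S" "y = f v" using bij by (metis bij_betw_imp_surj_on imageE)
    then show "y \<in> f ` ?B" using B_iff y by blast
  next
    fix y assume "y \<in> f ` ?B"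
    then obtain v where "v \<in> ?B" "y = f v" by blast
    then show "y \<in> bdry T ` {1..n}" using B_iff[of v] B_verts by blast
  qed
  then have "card (bdry T ` {1..n}) = card (f ` ?B)" by simp
  moreover have "card (bdry T ` {1..n}) = n" using T by (simp add: planar_tree_def card_image)
  moreover have "card (f ` ?B) = card ?B"
    using bij B_verts by (intro card_image) (metis bij_betw_imp_inj_on inj_on_subset)
  moreover have "card ?B = card (set (boundary_addrs t))" by (intro card_image) (simp add: inj_on_def)
  moreover have "card (set (boundary_addrs t)) = Suc (leaf_count t)"
    using distinct_card[OF distinct_boundary_addrs] by (simp add: length_boundary_addrs)
  ultimately show n_eq: "n = Suc (leaf_count t)" by simp
  have S: "planar_tree n ?S" using planar_tree_canon[OF t(2)] by (simp add: n_eq)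
  have B_bdry: "bdry ?S ` {1..n} = ?B" unfolding n_eq by (rule canon_bdry_image)
  have adj': "(f u, f v) \<in> adj T" if "(u, v) \<in> adj ?S" for u v
    using adj[of u v] is_tree_adj[OF ctree that] that by simp
  have B_iff': "f v \<in> bdry T ` {1..n} \<longleftrightarrow> v \<in> bdry ?S ` {1..n}" if "(u, v) \<in> adj ?S" for u v
    unfolding B_bdry using B_iff is_tree_adj(3)[OF ctree that] by blast
  \<comment> \<open>From a boundary vertex that already has the right label, the next one in
    \<open>T\<close> is unique; the image of the next one in \<open>canon t\<close> is also a
    candidate.\<close>
  have "i < n \<Longrightarrow> bdry T (Suc i) = f (bdry ?S (Suc i))" for i
  proof (induction i)
    case 0
    then show ?case using b by (simp add: canon_bdry boundary_addrs_def)
  next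
    case (Suc i)
    have i: "Suc i \<in> {1..n}" and i': "Suc i mod n + 1 = Suc (Suc i)" using Suc.prems by auto
    have "next_clockwise ?S (bdry ?S ` {1..n}) (bdry ?S (Suc i)) (bdry ?S (Suc (Suc i)))"
      using S i i' unfolding planar_tree_def by metis
    then have "next_clockwise T (bdry T ` {1..n}) (f (bdry ?S (Suc i))) (f (bdry ?S (Suc (Suc i))))"
      by (rule next_clockwise_hom[rotated -1]) (fact adj' rot planar_tree_dart_closed[OF S] B_iff')+
    then have 1: "next_clockwise T (bdry T ` {1..n}) (bdry T (Suc i)) (f (bdry ?S (Suc (Suc i))))"
      using Suc by simp
    have 2: "next_clockwise T (bdry T ` {1..n}) (bdry T (Suc i)) (bdry T (Suc (Suc i)))"
      using T i i' unfolding planar_tree_def by metis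
    have "deg T (bdry T (Suc i)) = 1" using T i by (simp add: planar_tree_def)
    then obtain x where x: "nbrs T (bdry T (Suc i)) = {x}" by (auto simp: deg_def card_1_singleton_iff)
    have "bdry ?S (Suc (Suc i)) \<in> ?B" unfolding B_bdry[symmetric] using Suc.prems by (intro imageI) simp
    then have 3: "f (bdry ?S (Suc (Suc i))) \<in> bdry T ` {1..n}" using B_iff B_verts by blast
    have 4: "bdry T (Suc (Suc i)) \<in> bdry T ` {1..n}" using Suc.prems by (intro imageI) simp
    show ?case by (rule next_clockwise_unique[OF x 4 3 2 1])
  qed
  then have "bdry T i = f (bdry ?S i)" if "i \<in> {1..n}" for i
    using that by (cases i) auto
  then have "planar_iso n ?S T f"
    unfolding planar_iso_def using bij adj rot is_tree_adj(1)[OF ctree] by (auto simp: nbrs_def simp del: canon_simps)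
  then show "planar_iso n ?S T (\<lambda>v. place T b w (decode v))" unfolding f_def .
qed

section \<open>Canonical trees as representatives of the classes of OG trees\<close>

lemma canon_internal_verts:
  "internal_verts (Suc (leaf_count t)) (canon t) = code ` {p. valid_addr t p \<and> p \<noteq> [] \<and> subtree_at t p \<noteq> Leaf}"
  unfolding internal_verts_def canon_bdry_image by (auto simp: set_boundary_addrs)

lemma OG_tree_canon:
  assumes t: "og_shape t" and k: "2 * k = Suc (leaf_count t)"
  shows "OG_tree k (canon t)"
proof -
  have "even (deg (canon t) v) \<and> 4 \<le> deg (canon t) v"
    if "v \<in> internal_verts (Suc (leaf_count t)) (canon t)" for v
  proof -
    obtain p where p: "v = code p" "valid_addr t p" "p \<noteq> []" "subtree_at t p \<noteq> Leaf"
      using \<open>v \<in> _\<close> unfolding canon_internal_verts by auto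
    then show ?thesis using arity_og_shape[OF t p(2,3)] canon_deg[OF p(2,3)] by auto
  qed
  then show ?thesis using planar_tree_canon[OF t] by (simp add: OG_tree_def k del: canon_simps)
qed

lemma O_dimension_canon:
  assumes t: "og_shape t" and k: "2 * k = Suc (leaf_count t)"
  shows "O_dimension k (canon t) = int (dimension t)"
proof (cases "k = 1")
  case True
  \<comment> \<open>For \<open>k = 1\<close> there is one leaf, whereas an inner node would force at
    least three.\<close>
  have "t = Leaf"
  proof (cases t)
    case (Node ts)
    then show ?thesis using t k True length_le_sum_list[of ts leaf_count] leaf_count_pos by auto
  qed
  then show ?thesis using True by (simp add: O_dimension_def)
next
  case False
  let ?P = "{p. valid_addr t p \<and> p \<noteq> []}"
  let ?I = "{p. valid_addr t p \<and> p \<noteq> [] \<and> subtree_at t p \<noteq> Leaf}"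
  have fin: "finite ?P" using finite_valid_addr[of t] by (rule finite_subset[rotated]) auto
  have "O_dimension k (canon t) = (\<Sum>p\<in>?I. int (deg (canon t) (code p)) - 3)"
  proof -
    have "O_dimension k (canon t) = (\<Sum>v\<in>code ` ?I. int (deg (canon t) v) - 3)"
      using False by (simp only: O_dimension_def k canon_internal_verts if_False)
    also have "\<dots> = (\<Sum>p\<in>?I. int (deg (canon t) (code p)) - 3)"
      by (subst sum.reindex) (simp_all add: inj_on_def comp_def)
    finally show ?thesis .
  qed
  also have "\<dots> = (\<Sum>p\<in>?I. int (arity t p - 2))"
  proof (intro sum.cong refl)
    fix p assume "p \<in> ?I"
    then show "int (deg (canon t) (code p)) - 3 = int (arity t p - 2)"
      using arity_og_shape[OF t, of p] canon_deg[of t p] by auto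
  qed
  \<comment> \<open>The leaves may be added: for them the truncated \<open>arity t p - 2\<close> is
    0.\<close>
  also have "\<dots> = (\<Sum>p\<in>?P. int (arity t p - 2))"
    using fin by (intro sum.mono_neutral_left) (auto simp: arity_def)
  also have "\<dots> = int (\<Sum>x\<in>set (subtrees t [0]). length (children (snd x)) - 2)"
    unfolding set_subtrees_root by (simp add: sum.reindex inj_on_def arity_def)
  also have "(\<Sum>x\<in>set (subtrees t [0]). length (children (snd x)) - 2) = dimension t"
    using distinct_subtrees[of t "[0]"] sum_list_arity_subtrees[of t "[0]"]
    by (simp add: distinct_map sum_list_distinct_conv_sum_set)
  finally show ?thesis .
qed

text \<open>Inner vertices have degree at least 4, so the labelled vertices are all the vertices of
  degree 1. Unfolding from label \<open>1\<close> provides \<open>t\<close>.\<close>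

lemma OG_tree_iso_canon:
  assumes T: "OG_tree k T" and k: "k \<ge> 1"
  obtains t where "og_shape t" "2 * k = Suc (leaf_count t)" "(canon t, T) \<in> planar_iso_rel (2 * k)"
proof -
  have pt: "planar_tree (2 * k) T" using T by (simp add: OG_tree_def)
  note tree = planar_tree_tree[OF pt]
  define b where "b = bdry T 1"
  have leaves: "bdry T ` {1..2 * k} = {v \<in> verts T. deg T v = 1}"
  proof (intro equalityI subsetI)
    fix v assume "v \<in> bdry T ` {1..2 * k}"
    then show "v \<in> {v \<in> verts T. deg T v = 1}" using pt by (auto simp: planar_tree_def)
  next
    fix v assume v: "v \<in> {v \<in> verts T. deg T v = 1}"
    then have "v \<notin> internal_verts (2 * k) T" using T by (auto simp: OG_tree_def)
    then show "v \<in> bdry T ` {1..2 * k}" using v by (auto simp: internal_verts_def)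
  qed
  have "deg T b = 1" using pt k by (simp add: b_def planar_tree_def)
  then obtain w where w: "nbrs T b = {w}" by (auto simp: deg_def card_1_singleton_iff)
  then have "(b, w) \<in> adj T" by (auto simp: nbrs_def)
  then have "reduced_walk T [w, b]" using is_tree_adj(1)[OF tree] by simp
  then obtain t where t: "unfolds T b w t" using unfolds_exists[OF pt] by blast
  have "even (deg T x) \<and> 4 \<le> deg T x" if "x \<in> verts T" "deg T x \<noteq> 1" for x
    using T that leaves unfolding OG_tree_def internal_verts_def by blast
  then have og: "og_shape t" by (rule unfolds_og_shape[OF t tree])
  have n: "2 * k \<ge> 1" using k by simp
  note iso = planar_iso_canon[OF pt n b_def w t og leaves]
  have "planar_tree (2 * k) (canon t)" using planar_tree_canon[OF og] iso(1) by simp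
  then have "(canon t, T) \<in> planar_iso_rel (2 * k)" using iso(2) pt by (auto simp: planar_iso_rel_def)
  then show ?thesis using that og iso(1) by blast
qed

text \<open>An isomorphism preserves label \<open>1\<close>, hence fixes \<open>[]\<close> and
  carries its only neighbour to \<open>[0]\<close>. Unfolding along this edge then recovers both
  \<open>t\<close> and \<open>t'\<close>.\<close>

lemma canon_iso_imp_eq:
  assumes "og_shape t" "og_shape t'" "(canon t, canon t') \<in> planar_iso_rel (Suc n)"
  shows "t = t'"
proof -
  obtain f where pt: "planar_tree (Suc n) (canon t)" "planar_tree (Suc n) (canon t')"
    and f: "planar_iso (Suc n) (canon t) (canon t') f"
    using assms(3) by (auto simp: planar_iso_rel_def)
  have root: "f (code []) = code []"
    using f by (auto simp: planar_iso_def canon_bdry boundary_addrs_def dest!: bspec[of _ _ 1])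
  have "unfolds (canon t) (code []) (code [0]) t" "unfolds (canon t') (code []) (code [0]) t'"
    using canon_unfolds[of t "[0]"] canon_unfolds[of t' "[0]"] assms by simp_all
  moreover from this(1) have "unfolds (canon t') (f (code [])) (f (code [0])) t"
    by (rule planar_iso_unfolds[OF pt f])
  moreover from this have "f (code [0]) \<in> nbrs (canon t') (code [])"
    unfolding root by (simp add: nbrs_def unfolds_adj)
  ultimately show ?thesis
    using unfolds_unique by (simp add: root canon_nbrs_root)
qed

text \<open>One of the \<open>2 * k\<close> boundary vertices serves as the root, which leaves
  \<open>2 * k - 1\<close> leaves.\<close>

definition OG_shapes :: "nat \<Rightarrow> nat \<Rightarrow> ptree set" where
  "OG_shapes k r = {t. og_shape t \<and> leaf_count t = 2 * k - 1 \<and> dimension t = r}"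

text \<open>The canonical embeddings form a system of representatives: each class contains one, and
  only one.\<close>

lemma OG_trees_of_dimension_eq:
  assumes k: "k \<ge> 1"
  shows "OG_trees_of_dimension k r = (\<lambda>t. planar_iso_rel (2 * k) `` {canon t}) ` OG_shapes k r"
    and "inj_on (\<lambda>t. planar_iso_rel (2 * k) `` {canon t}) (OG_shapes k r)"
proof -
  let ?R = "planar_iso_rel (2 * k)"
  have count: "2 * k = Suc (leaf_count t) \<longleftrightarrow> leaf_count t = 2 * k - 1" for t using k by auto
  have dim: "O_dimension k T = O_dimension k S" if "(S, T) \<in> ?R" for S T
    using that planar_iso_OG_tree(2) by (auto simp: planar_iso_rel_def)
  show "OG_trees_of_dimension k r = (\<lambda>t. ?R `` {canon t}) ` OG_shapes k r"
  proof (intro equalityI subsetI)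
    fix X assume "X \<in> OG_trees_of_dimension k r"
    then obtain T where T: "OG_tree k T" "O_dimension k T = int r" "X = ?R `` {T}"
      by (auto simp: OG_trees_of_dimension_def quotient_def)
    obtain t where t: "og_shape t" "2 * k = Suc (leaf_count t)" "(canon t, T) \<in> ?R"
      using OG_tree_iso_canon[OF T(1) k] by blast
    have "X = ?R `` {canon t}"
      using T(3) equiv_class_eq[OF equiv_planar_iso_rel t(3)] by simp
    moreover have "t \<in> OG_shapes k r"
      using t count T(2) dim[OF t(3)] O_dimension_canon[OF t(1,2)] by (simp add: OG_shapes_def)
    ultimately show "X \<in> (\<lambda>t. ?R `` {canon t}) ` OG_shapes k r" by blast
  next
    fix X assume "X \<in> (\<lambda>t. ?R `` {canon t}) ` OG_shapes k r"
    then obtain t where t: "og_shape t" "2 * k = Suc (leaf_count t)" "dimension t = r" "X = ?R `` {canon t}"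
      using count by (auto simp: OG_shapes_def)
    then show "X \<in> OG_trees_of_dimension k r"
      using OG_tree_canon[OF t(1,2)] O_dimension_canon[OF t(1,2)]
      unfolding OG_trees_of_dimension_def by (auto intro: quotientI)
  qed
  show "inj_on (\<lambda>t. ?R `` {canon t}) (OG_shapes k r)"
  proof (rule inj_onI)
    fix t t' assume t: "t \<in> OG_shapes k r" "t' \<in> OG_shapes k r" and eq: "?R `` {canon t} = ?R `` {canon t'}"
    then have og: "og_shape t" "og_shape t'" "2 * k = Suc (leaf_count t')" using k by (simp_all add: OG_shapes_def)
    have "planar_tree (2 * k) (canon t')" using planar_tree_canon[OF og(2)] og(3) by simp
    then have "(canon t, canon t') \<in> ?R"
      using eq_equiv_class[OF eq equiv_planar_iso_rel] by simp
    then show "t = t'" using canon_iso_imp_eq[OF og(1,2)] og(3) by simp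
  qed
qed

theorem mainTheorem3:
  shows "(\<forall>k r. k \<ge> 1 \<longrightarrow>
            finite (OG_trees_of_dimension k r) \<and>
            of_nat (card (OG_trees_of_dimension k r)) = coeff (fps_nth G_tree (2 * k)) r) \<and>
         algebraic_of_degree rational_functions (to_laurent G_tree) 3 \<and>
         qvar * (qvar + 1) * G_tree ^ 3 - qvar\<^sup>2 * xvar\<^sup>2 * G_tree\<^sup>2 - xvar\<^sup>2 * G_tree + xvar ^ 4 = 0"
proof (intro conjI allI impI)
  note series = tree_series_nth_0 tree_series_eq
  fix k r :: nat
  assume k: "k \<ge> 1"
  note eq = OG_trees_of_dimension_eq[OF k, of r]
  have fin: "finite {t \<in> {t. og_shape t}. leaf_count t = 2 * k - 1}"
    using finite_og_shape by simp
  have "finite (OG_shapes k r)"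
    by (rule finite_subset[OF _ fin]) (auto simp: OG_shapes_def)
  then show "finite (OG_trees_of_dimension k r)" by (simp add: eq(1))
  \<comment> \<open>The factor \<open>fps_X\<close> shifts the exponent from the
    \<open>2 * k\<close> boundary vertices to the \<open>2 * k - 1\<close> leaves of the plane
    tree.\<close>
  have "coeff (fps_nth G_tree (2 * k)) r = coeff (fps_nth tree_series (2 * k - 1)) r"
    using k by (simp add: G_tree_eq_X_times_tree_series[OF series])
  also have "\<dots> = of_nat (card (OG_shapes k r))"
    unfolding tree_series_def coeff_gen_fun[OF fin] by (simp add: OG_shapes_def)
  also have "card (OG_shapes k r) = card (OG_trees_of_dimension k r)"
    unfolding eq(1) by (rule card_image[OF eq(2), symmetric])
  finally show "of_nat (card (OG_trees_of_dimension k r)) = coeff (fps_nth G_tree (2 * k)) r" ..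
next
  note series = tree_series_nth_0 tree_series_eq
  show "algebraic_of_degree rational_functions (to_laurent G_tree) 3"
    by (rule tree_series_G_algebraic_of_degree_3[OF series])
  show "qvar * (qvar + 1) * G_tree ^ 3 - qvar\<^sup>2 * xvar\<^sup>2 * G_tree\<^sup>2 - xvar\<^sup>2 * G_tree + xvar ^ 4 = 0"
    by (rule G_tree_cubic[OF series])
qed

end
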